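(* Let $p$ be a prime, $n\ge 1$, let $\overline{G}=\mathrm{Sp}_{2n}(\overline{\mathbb F}_p)$, let $\sigma$ be a Steinberg endomorphism of $\overline{G}$, let $\overline{T}$ be a maximal $\sigma$-invariant torus of $\overline{G}$, and let $\overline{N}=N_{\overline{G}}(\overline{T})$. Then $\overline{T}$ has a complement in $\overline{N}$ if and only if $p=2$.
   Context: $\overline{\mathbb F}_p$ is the algebraic closure of the field $\mathbb F_p$, and $\mathrm{Sp}_{2n}(\overline{\mathbb F}_p)$ is the symplectic group regarded as a linear algebraic group. A Steinberg endomorphism of a connected linear algebraic group $\overline{G}$ is a surjective endomorphism $\sigma$ of the algebraic group $\overline{G}$ whose set of fixed points $\overline{G}_\sigma$ is finite. For subgroups $T\trianglelefteq N$ of a group, "$T$ has a complement in $N$" means that there is a subgroup $H$ with $N=T\rtimes H$, i.e. $N=TH$ and $T\cap H=1$; here $H$ is an abstract subgroup. *)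

theory Defs
  imports
    "HOL-Algebra.Algebraic_Closure_Type"
    "HOL-Algebra.Group_Action"
    "Jordan_Normal_Form.Determinant"
    "Berlekamp_Zassenhaus.Finite_Field"
begin

section \<open>Linear algebraic groups as closed subgroups of general linear groups\<close>

definition GL :: "nat \<Rightarrow> 'k::field mat monoid" where
  "GL m = units_of (ring_mat TYPE('k) m ())"

abbreviation matrix_group :: "nat \<Rightarrow> 'k::field mat set \<Rightarrow> 'k mat monoid" where
  "matrix_group m G \<equiv> (GL m)\<lparr>carrier := G\<rparr>"

text \<open>The functions on \<open>GL m\<close> given by elements of its coordinate ring, that is, by
  polynomials in the matrix entries and the inverse of the determinant.\<close>

inductive_set GL_regular :: "nat \<Rightarrow> ('k::field mat \<Rightarrow> 'k) set" for m :: nat where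
  const: "(\<lambda>A. c) \<in> GL_regular m"
| entry: "i < m \<Longrightarrow> j < m \<Longrightarrow> (\<lambda>A. A $$ (i, j)) \<in> GL_regular m"
| inverse_det: "(\<lambda>A. inverse (det A)) \<in> GL_regular m"
| add: "f \<in> GL_regular m \<Longrightarrow> g \<in> GL_regular m \<Longrightarrow> (\<lambda>A. f A + g A) \<in> GL_regular m"
| mult: "f \<in> GL_regular m \<Longrightarrow> g \<in> GL_regular m \<Longrightarrow> (\<lambda>A. f A * g A) \<in> GL_regular m"

definition zariski_closed :: "nat \<Rightarrow> 'k::field mat set \<Rightarrow> bool" where
  "zariski_closed m G \<longleftrightarrow>
     (\<exists>F \<subseteq> GL_regular m. G = {A \<in> carrier (GL m). \<forall>f\<in>F. f A = 0})"

definition linear_algebraic_group :: "nat \<Rightarrow> 'k::field mat set \<Rightarrow> bool" where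
  "linear_algebraic_group m G \<longleftrightarrow> subgroup G (GL m) \<and> zariski_closed m G"

text \<open>Regular functions on a closed subset of \<open>GL m\<close> are the restrictions of regular
  functions on \<open>GL m\<close>, so a map into \<open>GL k\<close> is a morphism of varieties iff each of its
  entries is such a restriction.\<close>

definition algebraic_group_hom ::
  "nat \<Rightarrow> 'k::field mat set \<Rightarrow> nat \<Rightarrow> 'k mat set \<Rightarrow> ('k mat \<Rightarrow> 'k mat) \<Rightarrow> bool" where
  "algebraic_group_hom m G k H \<phi> \<longleftrightarrow>
     \<phi> \<in> hom (matrix_group m G) (matrix_group k H) \<and>
     (\<forall>i<k. \<forall>j<k. \<exists>f\<in>GL_regular m. \<forall>A\<in>G. \<phi> A $$ (i, j) = f A)"

definition algebraic_group_isomorphic ::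
  "nat \<Rightarrow> 'k::field mat set \<Rightarrow> nat \<Rightarrow> 'k mat set \<Rightarrow> bool" where
  "algebraic_group_isomorphic m G k H \<longleftrightarrow>
     (\<exists>\<phi> \<psi>. algebraic_group_hom m G k H \<phi> \<and> algebraic_group_hom k H m G \<psi> \<and>
        (\<forall>A\<in>G. \<psi> (\<phi> A) = A) \<and> (\<forall>B\<in>H. \<phi> (\<psi> B) = B))"

definition steinberg_endomorphism ::
  "nat \<Rightarrow> 'k::field mat set \<Rightarrow> ('k mat \<Rightarrow> 'k mat) \<Rightarrow> bool" where
  "steinberg_endomorphism m G \<sigma> \<longleftrightarrow>
     algebraic_group_hom m G m G \<sigma> \<and> \<sigma> ` G = G \<and> finite {A \<in> G. \<sigma> A = A}"


section \<open>Tori\<close>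

definition diagonal_group :: "nat \<Rightarrow> 'k::field mat set" where
  "diagonal_group r = {A \<in> carrier (GL r). diagonal_mat A}"

definition torus :: "nat \<Rightarrow> 'k::field mat set \<Rightarrow> bool" where
  "torus m T \<longleftrightarrow> linear_algebraic_group m T \<and>
     (\<exists>r. algebraic_group_isomorphic m T r (diagonal_group r))"

definition maximal_torus :: "nat \<Rightarrow> 'k::field mat set \<Rightarrow> 'k mat set \<Rightarrow> bool" where
  "maximal_torus m G T \<longleftrightarrow> torus m T \<and> T \<subseteq> G \<and>
     (\<forall>S. torus m S \<and> S \<subseteq> G \<and> T \<subseteq> S \<longrightarrow> S = T)"


section \<open>The symplectic group\<close>

definition symplectic_form :: "nat \<Rightarrow> 'k::field mat" where
  "symplectic_form n = four_block_mat (0\<^sub>m n n) (1\<^sub>m n) (- 1\<^sub>m n) (0\<^sub>m n n)"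

definition Sp :: "nat \<Rightarrow> 'k::field mat set" where
  "Sp n = {A \<in> carrier (GL (2 * n)).
     transpose_mat A * symplectic_form n * A = symplectic_form n}"


section \<open>Complements\<close>

definition has_complement :: "('a, 'b) monoid_scheme \<Rightarrow> 'a set \<Rightarrow> 'a set \<Rightarrow> bool" where
  "has_complement G T N \<longleftrightarrow>
     (\<exists>H. subgroup H G \<and> H \<subseteq> N \<and> N = T <#>\<^bsub>G\<^esub> H \<and> T \<inter> H = {\<one>\<^bsub>G\<^esub>})"

end

theory Submission
  imports Defs "HOL-Library.Function_Algebras"
begin

text \<open>Every maximal torus of \<open>Sp n\<close> is conjugate to the group of diagonal symplectic matrices
  (\<open>maximal_torus_conjugate_standard\<close>), and conjugation carries complements to complements.
  So it suffices to treat the diagonal torus. An element of its normalizer permutes the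
  coordinate lines, because the coordinate characters of the diagonal torus are pairwise
  different; hence the normalizer consists of the monomial symplectic matrices
  (\<open>normalizer_monomial\<close>, \<open>monomial_normalizes\<close>).

  In characteristic 2 the entries of the symplectic form are 0 and 1, so the permutation
  underlying a monomial symplectic matrix preserves the form exactly. The symplectic
  permutation matrices are therefore a complement. In other characteristics, let \<open>w\<close> exchange
  the two vectors of a hyperbolic pair, up to a sign, and fix the other basis vectors. A
  complement would contain some \<open>h = d\<inverse> w\<close> with \<open>d\<close> in the torus. On the hyperbolic pair \<open>h\<^sup>2\<close>
  is \<open>-1\<close>, whatever \<open>d\<close> is, since the two diagonal entries of \<open>d\<close> there are inverse to each
  other. But \<open>h\<^sup>2\<close> is diagonal, so it lies in the torus and in the complement without being
  the identity.

  The conjugacy of maximal tori has an elementary proof over the algebraic closure of a finite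
  field. As an abstract group a torus is a power of the multiplicative group of the field. So
  it is commutative, and each of its elements has a finite order that is not divisible by the
  characteristic (\<open>torus_commute\<close>, \<open>torus_torsion\<close>). Each element is thus a root of a separable
  polynomial \<open>X\<^sup>k - 1\<close> and is diagonalizable. Since the torus spans a finite-dimensional space of
  matrices, common eigenvectors can be found by refining finitely many times
  (\<open>common_eigenvectors_separate\<close>). A symplectic basis is then built from common eigenvectors,
  one hyperbolic pair at a time: orthogonalizing a common eigenvector against such a pair
  only adds vectors of the same weight (\<open>orthogonalize_pair\<close>). In this basis the torus is
  diagonal, and maximality forces it to be the whole conjugate of the diagonal torus.\<close>

no_notation fps_nth (infixl \<open>$\<close> 75)

section \<open>Roots of unity and orders of elements in algebraic closures\<close>

text \<open>The root of \<open>X\<^sup>3 - X + 1\<close> is as required: the polynomial takes the value 1 at 0, 1 and -1.\<close>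

lemma ex_generic_unit:
  obtains a :: "'k::alg_closed_field" where "a \<noteq> 0" "a \<noteq> 1" "a * a \<noteq> 1"
proof -
  let ?q = "[:1, - 1, 0, 1:] :: 'k poly"
  obtain a where "poly ?q a = 0"
    using alg_closed_imp_poly_has_root[of ?q] by auto
  then have a: "1 + a * (a * a - 1) = 0" by (simp add: algebra_simps)
  have "a \<noteq> 0" using a by auto
  moreover have "a * a \<noteq> 1" using a by auto
  moreover have "a \<noteq> 1" using a by auto
  ultimately show ?thesis using that by blast
qed

text \<open>The derivative of \<open>X\<^sup>k - 1\<close> vanishes only at 0, so all \<open>k\<close> linear factors are different.\<close>

lemma card_roots_of_unity:
  assumes k: "of_nat k \<noteq> (0 :: 'k::alg_closed_field)"
  shows "card {z::'k. z ^ k = 1} = k"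
proof -
  have k0: "k > 0" using k by (cases k) auto
  let ?q = "monom 1 k - 1 :: 'k poly"
  have deg: "degree ?q = k"
  proof -
    have "degree (monom 1 k + (- 1) :: 'k poly) = degree (monom 1 k :: 'k poly)"
      by (rule degree_add_eq_left) (use k0 in \<open>simp add: degree_monom_eq\<close>)
    then show ?thesis by (simp add: degree_monom_eq)
  qed
  have q0: "?q \<noteq> 0" using deg k0 by (metis degree_0 less_irrefl)
  have root: "poly ?q z = 0 \<longleftrightarrow> z ^ k = 1" for z by (simp add: poly_monom)
  obtain M where M: "size M = k" "?q = smult (lead_coeff ?q) (\<Prod>x\<in>#M. [:-x, 1:])"
    using alg_closed_imp_factorization[OF q0] deg by metis
  have lc: "lead_coeff ?q \<noteq> 0" using q0 leading_coeff_0_iff by blast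
  have set: "set_mset M = {z. z ^ k = 1}"
  proof -
    have "poly ?q z = 0 \<longleftrightarrow> z \<in># M" for z
    proof -
      have "poly ?q z = lead_coeff ?q * (\<Prod>x\<in>#M. z - x)"
        by (subst M(2)) (simp add: poly_prod_mset)
      then show ?thesis using lc by (auto simp: prod_mset_zero_iff)
    qed
    then show ?thesis using root by auto
  qed
  have one: "count M z \<le> 1" for z
  proof (rule ccontr)
    assume "\<not> count M z \<le> 1"
    then have c2: "count M z \<ge> 2" by simp
    then have zM: "z \<in># M" by (metis count_greater_zero_iff less_le_trans zero_less_numeral)
    have "z \<in># M - {#z#}" using c2
      by (metis One_nat_def Suc_1 count_single diff_is_0_eq' in_diff_count not_less not_less_eq_eq count_greater_zero_iff less_le_trans lessI)
    then obtain B where B: "M = add_mset z (add_mset z B)"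
      using zM by (metis insert_DiffM)
    define r where "r = smult (lead_coeff ?q) (\<Prod>x\<in>#B. [:-x, 1:])"
    have qr: "?q = [:-z, 1:] * ([:-z, 1:] * r)"
      by (subst M(2)) (simp add: B r_def mult_smult_right)
    have "poly (pderiv ?q) z = 0"
      by (subst qr) (simp only: pderiv_mult poly_add poly_mult, simp)
    then have "of_nat k * z ^ (k - 1) = 0"
      by (simp add: pderiv_diff pderiv_monom poly_monom)
    then have "z = 0" using k by simp
    moreover have "z ^ k = 1" using zM set by auto
    ultimately show False using k0 by (simp add: power_0_left)
  qed
  have "size M = (\<Sum>z\<in>set_mset M. count M z)" by (simp add: size_multiset_overloaded_eq)
  also have "\<dots> = (\<Sum>z\<in>set_mset M. 1)"
    by (rule sum.cong[OF refl]) (metis One_nat_def count_greater_zero_iff le_antisym one Suc_leI)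
  finally show ?thesis using M(1) set by simp
qed

text \<open>For \<open>0 < j < k\<close>, fewer than \<open>k\<close> elements satisfy \<open>z\<^sup>j = 1\<close>, so some \<open>k\<close>-th root of unity \<open>w\<close> does not;
  multiplication by \<open>w\<close> permutes the roots and scales the sum by a factor other than 1.\<close>

lemma sum_inverse_powers_of_roots_of_unity:
  assumes k: "of_nat k \<noteq> (0 :: 'k::alg_closed_field)" and j: "j < k"
  shows "(\<Sum>z\<in>{z::'k. z ^ k = 1}. inverse z ^ j) = (if j = 0 then of_nat k else 0)"
proof (cases "j = 0")
  case True
  then show ?thesis by (simp add: card_roots_of_unity[OF k])
next
  case False
  let ?Z = "{z::'k. z ^ k = 1}"
  have k0: "k > 0" using j by simp
  have nz: "z \<noteq> 0" if "z \<in> ?Z" for z using that k0 by (auto simp: power_0_left)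
  have "\<exists>w\<in>?Z. w ^ j \<noteq> 1"
  proof (rule ccontr)
    assume "\<not> ?thesis"
    then have sub: "?Z \<subseteq> {z. z ^ j = 1}" by auto
    let ?q = "monom 1 j - 1 :: 'k poly"
    have "degree (monom 1 j + (- 1) :: 'k poly) = degree (monom 1 j :: 'k poly)"
      by (rule degree_add_eq_left) (use False in \<open>simp add: degree_monom_eq\<close>)
    then have deg: "degree ?q = j" by (simp add: degree_monom_eq)
    then have q0: "?q \<noteq> 0" using False by (metis degree_0)
    have eq: "{z. z ^ j = 1} = {z. poly ?q z = 0}" by (auto simp: poly_monom)
    have "card ?Z \<le> card {z. poly ?q z = 0}"
      using sub eq poly_roots_finite[OF q0] by (metis card_mono)
    also have "\<dots> \<le> j" using card_poly_roots_bound[OF q0] deg by simp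
    finally show False using card_roots_of_unity[OF k] j by simp
  qed
  then obtain w where w: "w \<in> ?Z" "w ^ j \<noteq> 1" by blast
  have bij: "bij_betw (\<lambda>z. w * z) ?Z ?Z"
    by (rule bij_betwI[where g = "\<lambda>z. inverse w * z"])
       (use w nz[OF w(1)] in \<open>auto simp: power_mult_distrib field_simps\<close>)
  have "(\<Sum>z\<in>?Z. inverse z ^ j) = (\<Sum>z\<in>?Z. inverse (w * z) ^ j)"
    using sum.reindex_bij_betw[OF bij, of "\<lambda>z. inverse z ^ j"] by simp
  also have "\<dots> = inverse w ^ j * (\<Sum>z\<in>?Z. inverse z ^ j)"
    by (simp add: sum_distrib_left power_mult_distrib)
  finally have "(1 - inverse w ^ j) * (\<Sum>z\<in>?Z. inverse z ^ j) = 0"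
    by (simp add: algebra_simps)
  moreover have "inverse w ^ j \<noteq> 1" using w(2)
    by (simp add: power_inverse)
  ultimately show ?thesis using False by simp
qed

interpretation to_ac_hom: map_poly_comm_ring_hom "to_ac :: 'a::field \<Rightarrow> 'a alg_closure"
  by unfold_locales auto

text \<open>If \<open>x\<close> is a root of \<open>q\<close>, then the values at \<open>x\<close> of all polynomials over the finite field are
  already taken by the finitely many of degree at most \<open>degree q\<close>. So the powers of \<open>x\<close> repeat.\<close>

lemma alg_closure_finite_order:
  fixes x :: "'a::{finite,field} alg_closure"
  assumes "x \<noteq> 0"
  obtains k where "k > 0" "x ^ k = 1"
proof -
  define ev where "ev f = poly (map_poly to_ac f) x" for f :: "'a poly"
  obtain q :: "'a poly" where q: "q \<noteq> 0" "ev q = 0"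
    using alg_closure_algebraic[of x] unfolding ev_def by metis
  have ev_mult: "ev (f * g) = ev f * ev g" and ev_add: "ev (f + g) = ev f + ev g" for f g
    by (simp_all add: ev_def to_ac_hom.hom_mult to_ac_hom.hom_add)
  have "finite (ev ` (Poly ` {cs. length cs \<le> Suc (degree q)}))"
    using finite_lists_length_le[of "UNIV :: 'a set" "Suc (degree q)"] by simp
  moreover have "range ev \<subseteq> ev ` (Poly ` {cs. length cs \<le> Suc (degree q)})"
  proof
    fix y assume "y \<in> range ev"
    then obtain f where y: "y = ev f" by blast
    have f: "f = (f div q) * q + f mod q" by simp
    have "ev f = ev (f mod q)"
      by (subst f) (simp only: ev_add ev_mult q mult_zero_right add_0_left)
    moreover have "degree (f mod q) \<le> degree q"
      using degree_mod_less[OF q(1), of f] by auto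
    then have "length (coeffs (f mod q)) \<le> Suc (degree q)"
      by (cases "f mod q = 0") (auto simp: length_coeffs_degree)
    then have "f mod q \<in> Poly ` {cs. length cs \<le> Suc (degree q)}"
      by (intro image_eqI[of _ _ "coeffs (f mod q)"]) auto
    ultimately show "y \<in> ev ` (Poly ` {cs. length cs \<le> Suc (degree q)})" using y by blast
  qed
  ultimately have fin: "finite (range ev)" by (rule rev_finite_subset)
  have "x ^ i = ev (monom 1 i)" for i
    by (simp add: ev_def map_poly_monom poly_monom)
  then have "range (\<lambda>i. x ^ i) \<subseteq> range ev" by auto
  then have "finite (range (\<lambda>i::nat. x ^ i))" using fin finite_subset by blast
  then have "\<not> inj (\<lambda>i::nat. x ^ i)" using finite_imageD infinite_UNIV_nat by blast
  then obtain i j :: nat where "i \<noteq> j" "x ^ i = x ^ j" by (auto simp: inj_def)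
  then obtain i j :: nat where ij: "i < j" "x ^ i = x ^ j" by (metis nat_neq_iff)
  have "x ^ i * x ^ (j - i) = x ^ i * 1" using ij by (metis power_add le_add_diff_inverse less_imp_le mult_1_right)
  then have "x ^ (j - i) = 1" using assms by simp
  then show ?thesis using that[of "j - i"] ij by simp
qed

text \<open>Factors \<open>p\<close> of the exponent can be removed, since \<open>y\<^sup>p = 1\<close> means \<open>(y - 1)\<^sup>p = 0\<close>.\<close>

lemma alg_closure_order_prime_to_char:
  fixes x :: "'a::{finite,field} alg_closure"
  assumes "x \<noteq> 0" and char: "prime CHAR('a)"
  obtains k where "of_nat k \<noteq> (0 :: 'a alg_closure)" "x ^ k = 1"
proof -
  have frob: "y = 1" if "y ^ CHAR('a) = 1" for y :: "'a alg_closure"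
  proof -
    have "((y - 1) + 1) ^ CHAR('a alg_closure) = (y - 1) ^ CHAR('a alg_closure) + 1 ^ CHAR('a alg_closure)"
      by (rule freshmans_dream) (use char in simp_all)
    then have "(y - 1) ^ CHAR('a) = 0" using that by simp
    then show ?thesis by simp
  qed
  have "\<exists>k. of_nat k \<noteq> (0 :: 'a alg_closure) \<and> x ^ k = 1" if "m > 0" "x ^ m = 1" for m
    using that
  proof (induction m rule: less_induct)
    case (less m)
    show ?case
    proof (cases "of_nat m = (0 :: 'a alg_closure)")
      case True
      then have "CHAR('a) dvd m" using of_nat_eq_0_iff_char_dvd[of m, where 'a = "'a alg_closure"] by simp
      then obtain l where l: "m = l * CHAR('a)" by (metis dvdE mult.commute)
      have "(x ^ l) ^ CHAR('a) = 1" using less.prems l by (simp add: power_mult)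
      then have "x ^ l = 1" by (rule frob)
      moreover have "l < m" "l > 0" using l less.prems prime_gt_1_nat[OF char] by auto
      ultimately show ?thesis using less.IH by blast
    qed (use less.prems in blast)
  qed
  then show ?thesis using alg_closure_finite_order[OF assms(1)] that by metis
qed

section \<open>Common eigenvectors of commuting matrices of finite order\<close>

lemma sum_fun_apply: "sum f S x = (\<Sum>a\<in>S. f a x)"
  for f :: "'a \<Rightarrow> 'b \<Rightarrow> 'c::comm_monoid_add"
  by (induction S rule: infinite_finite_induct) auto

lemma pow_mat_comm:
  assumes "A \<in> carrier_mat m m" "B \<in> carrier_mat m m" "A * B = B * A"
  shows "A ^\<^sub>m j * B = B * A ^\<^sub>m j"
proof (induction j)
  case 0
  show ?case using assms by simp
next
  case (Suc j)
  have P: "A ^\<^sub>m j \<in> carrier_mat m m" using assms(1) by simp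
  have "A ^\<^sub>m Suc j * B = A ^\<^sub>m j * (B * A)"
    using assoc_mult_mat[OF P assms(1,2)] assms(3) by simp
  also have "\<dots> = (B * A ^\<^sub>m j) * A"
    using assoc_mult_mat[OF P assms(2,1)] Suc by simp
  also have "\<dots> = B * A ^\<^sub>m Suc j"
    using assoc_mult_mat[OF assms(2) P assms(1)] by simp
  finally show ?case .
qed

text \<open>Up to the factor \<open>k\<close>, the projection to the eigenspace of \<open>A\<close> for the eigenvalue \<open>z\<close>, when
  \<open>A\<^sup>k = 1\<close> and \<open>z\<^sup>k = 1\<close>. It is a polynomial in \<open>A\<close>, so that it commutes with every matrix that
  commutes with \<open>A\<close>.\<close>

definition isotypic :: "nat \<Rightarrow> 'k::field mat \<Rightarrow> nat \<Rightarrow> 'k \<Rightarrow> 'k mat" where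
  "isotypic m A k z = mat m m (\<lambda>(i, l). \<Sum>j<k. inverse z ^ j * (A ^\<^sub>m j) $$ (i, l))"

lemma isotypic_carrier [simp]: "isotypic m A k z \<in> carrier_mat m m"
  by (simp add: isotypic_def)

lemma isotypic_comm:
  assumes A: "A \<in> carrier_mat m m" and B: "B \<in> carrier_mat m m" and comm: "A * B = B * A"
  shows "B * isotypic m A k z = isotypic m A k z * B"
proof (rule eq_matI)
  fix i l assume "i < dim_row (isotypic m A k z * B)" "l < dim_col (isotypic m A k z * B)"
  then have i: "i < m" and l: "l < m" using B by (auto simp: isotypic_def)
  have P: "A ^\<^sub>m j \<in> carrier_mat m m" for j using A by simp
  have PB: "(\<Sum>q<m. B $$ (i, q) * (A ^\<^sub>m j) $$ (q, l)) = (\<Sum>q<m. (A ^\<^sub>m j) $$ (i, q) * B $$ (q, l))" for j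
  proof -
    have "(B * A ^\<^sub>m j) $$ (i, l) = (A ^\<^sub>m j * B) $$ (i, l)"
      using pow_mat_comm[OF A B comm, of j] by simp
    then show ?thesis using i l B P[of j] A
      by (simp add: scalar_prod_def lessThan_atLeast0)
  qed
  have "(B * isotypic m A k z) $$ (i, l)
      = (\<Sum>q<m. B $$ (i, q) * (\<Sum>j<k. inverse z ^ j * (A ^\<^sub>m j) $$ (q, l)))"
    using i l B by (simp add: isotypic_def scalar_prod_def lessThan_atLeast0)
  also have "\<dots> = (\<Sum>j<k. inverse z ^ j * (\<Sum>q<m. B $$ (i, q) * (A ^\<^sub>m j) $$ (q, l)))"
    unfolding sum_distrib_left by (subst sum.swap) (simp add: mult.left_commute)
  also have "\<dots> = (\<Sum>j<k. inverse z ^ j * (\<Sum>q<m. (A ^\<^sub>m j) $$ (i, q) * B $$ (q, l)))"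
    by (simp only: PB)
  also have "\<dots> = (\<Sum>q<m. (\<Sum>j<k. inverse z ^ j * (A ^\<^sub>m j) $$ (i, q)) * B $$ (q, l))"
    unfolding sum_distrib_left sum_distrib_right by (subst sum.swap) (simp add: mult.assoc)
  also have "\<dots> = (isotypic m A k z * B) $$ (i, l)"
    using i l B by (simp add: isotypic_def scalar_prod_def lessThan_atLeast0)
  finally show "(B * isotypic m A k z) $$ (i, l) = (isotypic m A k z * B) $$ (i, l)" .
qed (use B in \<open>auto simp: isotypic_def\<close>)

text \<open>Multiplication by \<open>A\<close> shifts the summation index; \<open>A\<^sup>k = 1\<close> and \<open>z\<^sup>k = 1\<close> close the cycle.\<close>

lemma isotypic_eigen:
  assumes A: "A \<in> carrier_mat m m" and Ak: "A ^\<^sub>m k = 1\<^sub>m m" and z: "z ^ k = 1" and k: "k > 0"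
  shows "isotypic m A k z * A = z \<cdot>\<^sub>m isotypic m A k z"
proof (rule eq_matI)
  fix i l assume "i < dim_row (z \<cdot>\<^sub>m isotypic m A k z)" "l < dim_col (z \<cdot>\<^sub>m isotypic m A k z)"
  then have i: "i < m" and l: "l < m" by (auto simp: isotypic_def)
  have P: "A ^\<^sub>m j \<in> carrier_mat m m" for j using A by simp
  have z0: "z \<noteq> 0" using z k by (auto simp: power_0_left)
  define g where "g j = inverse z ^ j * (A ^\<^sub>m j) $$ (i, l)" for j
  have gk: "g k = g 0" using z Ak A by (simp add: g_def power_inverse)
  have "(isotypic m A k z * A) $$ (i, l)
      = (\<Sum>q<m. (\<Sum>j<k. inverse z ^ j * (A ^\<^sub>m j) $$ (i, q)) * A $$ (q, l))"
    using i l A by (simp add: isotypic_def scalar_prod_def lessThan_atLeast0)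
  also have "\<dots> = (\<Sum>j<k. inverse z ^ j * (\<Sum>q<m. (A ^\<^sub>m j) $$ (i, q) * A $$ (q, l)))"
    unfolding sum_distrib_left sum_distrib_right by (subst sum.swap) (simp add: mult.assoc)
  also have "\<dots> = (\<Sum>j<k. z * g (Suc j))"
  proof (rule sum.cong[OF refl])
    fix j
    have "(\<Sum>q<m. (A ^\<^sub>m j) $$ (i, q) * A $$ (q, l)) = (A ^\<^sub>m Suc j) $$ (i, l)"
      using i l A P[of j] by (simp add: scalar_prod_def lessThan_atLeast0)
    then show "inverse z ^ j * (\<Sum>q<m. (A ^\<^sub>m j) $$ (i, q) * A $$ (q, l)) = z * g (Suc j)"
      using z0 by (simp add: g_def)
  qed
  also have "\<dots> = z * (\<Sum>j<k. g (Suc j))" by (simp add: sum_distrib_left)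
  also have "(\<Sum>j<k. g (Suc j)) = (\<Sum>j<k. g j)"
  proof -
    have "(\<Sum>j<k. g (Suc j)) + g 0 = (\<Sum>j<k. g j) + g k"
      by (metis add.commute sum.lessThan_Suc sum.lessThan_Suc_shift)
    then show ?thesis using gk by simp
  qed
  also have "z * (\<Sum>j<k. g j) = (z \<cdot>\<^sub>m isotypic m A k z) $$ (i, l)"
    using i l by (simp add: isotypic_def g_def)
  finally show "(isotypic m A k z * A) $$ (i, l) = (z \<cdot>\<^sub>m isotypic m A k z) $$ (i, l)" .
qed (use A in \<open>auto simp: isotypic_def\<close>)

lemma sum_isotypic:
  fixes A :: "'k::alg_closed_field mat"
  assumes A: "A \<in> carrier_mat m m" and k: "of_nat k \<noteq> (0::'k)" and i: "i < m" and l: "l < m"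
  shows "(\<Sum>z | z ^ k = 1. isotypic m A k z $$ (i, l)) = of_nat k * 1\<^sub>m m $$ (i, l)"
proof -
  have k0: "k > 0" using k by (cases k) auto
  have "(\<Sum>z | z ^ k = 1. isotypic m A k z $$ (i, l))
      = (\<Sum>j<k. (\<Sum>z | z ^ k = 1. inverse z ^ j) * (A ^\<^sub>m j) $$ (i, l))"
    using i l unfolding isotypic_def by (simp add: sum_distrib_right) (rule sum.swap)
  also have "\<dots> = (\<Sum>j<k. (if j = 0 then of_nat k * (A ^\<^sub>m j) $$ (i, l) else 0))"
    by (rule sum.cong[OF refl]) (use sum_inverse_powers_of_roots_of_unity[OF k] in simp)
  also have "\<dots> = of_nat k * 1\<^sub>m m $$ (i, l)" using k0 A by (simp add: sum.delta)
  finally show ?thesis .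
qed

text \<open>The vectors \<open>isotypic m A k z *\<^sub>v y\<close> sum up to \<open>k\<close> times \<open>y\<close>, so one of them is not
  annihilated by \<open>a\<close>. It stays an eigenvector of whatever commutes with \<open>A\<close>. Keeping track of a
  functional, rather than of a decomposition into eigenspaces, makes the step easy to iterate.\<close>

lemma eigenvector_refine:
  fixes A :: "'k::alg_closed_field mat"
  assumes A: "A \<in> carrier_mat m m" and Ak: "A ^\<^sub>m k = 1\<^sub>m m" and k: "of_nat k \<noteq> (0::'k)"
    and y: "y \<in> carrier_vec m" and a: "a \<in> carrier_vec m" and ay: "a \<bullet> y \<noteq> 0"
  obtains x z where "x \<in> carrier_vec m" "A *\<^sub>v x = z \<cdot>\<^sub>v x" "a \<bullet> x \<noteq> 0"
    "\<And>B b. B \<in> carrier_mat m m \<Longrightarrow> A * B = B * A \<Longrightarrow> B *\<^sub>v y = b \<cdot>\<^sub>v y \<Longrightarrow> B *\<^sub>v x = b \<cdot>\<^sub>v x"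
proof -
  let ?Q = "isotypic m A k"
  have k0: "k > 0" using k by (cases k) auto
  have dot: "a \<bullet> (?Q z *\<^sub>v y) = (\<Sum>i<m. \<Sum>l<m. a $ i * ?Q z $$ (i, l) * y $ l)" for z
    using a y carrier_matD[OF isotypic_carrier[of m A k z]]
    by (simp add: scalar_prod_def lessThan_atLeast0 sum_distrib_left mult.assoc)
  have "(\<Sum>z | z ^ k = 1. a \<bullet> (?Q z *\<^sub>v y))
      = (\<Sum>i<m. \<Sum>l<m. a $ i * (\<Sum>z | z ^ k = 1. ?Q z $$ (i, l)) * y $ l)"
    unfolding dot
    by (subst sum.swap, rule sum.cong[OF refl], subst sum.swap)
       (simp add: sum_distrib_left sum_distrib_right)
  also have "\<dots> = (\<Sum>i<m. \<Sum>l<m. if l = i then of_nat k * (a $ i * y $ i) else 0)"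
    by (intro sum.cong refl) (auto simp: sum_isotypic[OF A k])
  also have "\<dots> = of_nat k * (a \<bullet> y)"
    using a y by (simp add: scalar_prod_def lessThan_atLeast0 sum_distrib_left)
  finally have "(\<Sum>z | z ^ k = 1. a \<bullet> (?Q z *\<^sub>v y)) \<noteq> 0" using k ay by simp
  then obtain z where z: "z ^ k = 1" and nz: "a \<bullet> (?Q z *\<^sub>v y) \<noteq> 0"
    by (metis (mono_tags, lifting) sum.neutral mem_Collect_eq)
  let ?x = "?Q z *\<^sub>v y"
  have x: "?x \<in> carrier_vec m" using y mult_mat_vec_carrier isotypic_carrier by blast
  have eq: "B *\<^sub>v ?x = ?Q z *\<^sub>v (B *\<^sub>v y)" if "B \<in> carrier_mat m m" "A * B = B * A" for B
    using isotypic_comm[OF A that] y that(1)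
    by (metis assoc_mult_mat_vec isotypic_carrier)
  have "A *\<^sub>v ?x = (?Q z * A) *\<^sub>v y"
    using eq[OF A refl] A y by (metis assoc_mult_mat_vec isotypic_carrier)
  also have "\<dots> = z \<cdot>\<^sub>v ?x"
    unfolding isotypic_eigen[OF A Ak z k0] using y
    by (intro eq_vecI) (auto simp: isotypic_def)
  finally have 1: "A *\<^sub>v ?x = z \<cdot>\<^sub>v ?x" .
  have 2: "B *\<^sub>v ?x = b \<cdot>\<^sub>v ?x"
    if "B \<in> carrier_mat m m" "A * B = B * A" "B *\<^sub>v y = b \<cdot>\<^sub>v y" for B b
    using eq[OF that(1,2)] that(3) mult_mat_vec[OF isotypic_carrier y] by metis
  show ?thesis using that[OF x 1 nz 2] by blast
qed

lemma finite_common_eigenvector: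
  fixes F :: "'k::alg_closed_field mat set"
  assumes "finite F" "F \<subseteq> carrier_mat m m"
    and "\<And>A B. A \<in> F \<Longrightarrow> B \<in> F \<Longrightarrow> A * B = B * A"
    and "\<And>A. A \<in> F \<Longrightarrow> \<exists>k. of_nat k \<noteq> (0::'k) \<and> A ^\<^sub>m k = 1\<^sub>m m"
    and a: "a \<in> carrier_vec m" and y: "y \<in> carrier_vec m" and "a \<bullet> y \<noteq> 0"
  shows "\<exists>x\<in>carrier_vec m. a \<bullet> x \<noteq> 0 \<and> (\<forall>A\<in>F. \<exists>c. A *\<^sub>v x = c \<cdot>\<^sub>v x)"
  using assms(1-4)
proof (induction F rule: finite_induct)
  case empty
  show ?case using y assms(7) by blast
next
  case (insert A F)
  obtain x where x: "x \<in> carrier_vec m" "a \<bullet> x \<noteq> 0" "\<forall>A\<in>F. \<exists>c. A *\<^sub>v x = c \<cdot>\<^sub>v x"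
    using insert.IH insert.prems by (metis insert_subset insertCI)
  obtain k where k: "of_nat k \<noteq> (0::'k)" "A ^\<^sub>m k = 1\<^sub>m m" using insert.prems(3) by blast
  have A: "A \<in> carrier_mat m m" using insert.prems(1) by simp
  obtain x' z where x': "x' \<in> carrier_vec m" "A *\<^sub>v x' = z \<cdot>\<^sub>v x'" "a \<bullet> x' \<noteq> 0"
    "\<And>B b. B \<in> carrier_mat m m \<Longrightarrow> A * B = B * A \<Longrightarrow> B *\<^sub>v x = b \<cdot>\<^sub>v x \<Longrightarrow> B *\<^sub>v x' = b \<cdot>\<^sub>v x'"
    using eigenvector_refine[OF A k(2,1) x(1) a x(2)] by metis
  have "\<exists>c. B *\<^sub>v x' = c \<cdot>\<^sub>v x'" if "B \<in> F" for B
    using x(3) x'(4)[of B] that insert.prems(1,2) by (metis insertCI subset_iff)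
  then show ?case using x' by blast
qed

interpretation fun_space: vector_space "\<lambda>(c::'k::field) (f::'i \<Rightarrow> 'k) i. c * f i"
  by unfold_locales (auto simp: fun_eq_iff algebra_simps)

text \<open>The finite-dimensionality of the space of matrices, in the form that allows passing from an
  arbitrary set of matrices to a finite subset. Matrices are viewed as functions with support
  in the index square.\<close>

lemma matrices_finite_span:
  fixes T :: "'k::field mat set"
  obtains F where "finite F" "F \<subseteq> T"
    "\<And>A. A \<in> T \<Longrightarrow> \<exists>c. \<forall>i<m. \<forall>j<m. A $$ (i, j) = (\<Sum>B\<in>F. c B * B $$ (i, j))"
proof -
  define e where "e A = (\<lambda>q. if fst q < m \<and> snd q < m then A $$ q else 0)" for A :: "'k mat"
  define U where "U = (\<lambda>p q. if p = q then 1 else 0 :: 'k) ` ({..<m} \<times> {..<m})"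
  have U: "finite U" by (simp add: U_def)
  have "e A \<in> fun_space.span U" for A
  proof -
    have "e A = (\<Sum>p\<in>{..<m} \<times> {..<m}. (\<lambda>q. A $$ p * (if p = q then 1 else 0)))"
    proof
      fix q
      have "(\<Sum>p\<in>{..<m} \<times> {..<m}. (\<lambda>q. A $$ p * (if p = q then 1 else 0))) q
          = (\<Sum>p\<in>{..<m} \<times> {..<m}. A $$ p * (if p = q then 1 else 0))"
        by (simp add: sum_fun_apply)
      also have "\<dots> = (if q \<in> {..<m} \<times> {..<m} then A $$ q else 0)"
        by (simp add: if_distrib cong: if_cong)
      also have "\<dots> = e A q" by (cases q) (simp add: e_def)
      finally show "e A q = (\<Sum>p\<in>{..<m} \<times> {..<m}. (\<lambda>q. A $$ p * (if p = q then 1 else 0))) q" ..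
    qed
    also have "\<dots> \<in> fun_space.span U"
      by (intro fun_space.span_sum fun_space.span_scale fun_space.span_base) (auto simp: U_def)
    finally show ?thesis .
  qed
  then have sub: "e ` T \<subseteq> fun_space.span U" by blast
  obtain B where B: "B \<subseteq> e ` T" "fun_space.independent B" "e ` T \<subseteq> fun_space.span B"
    using fun_space.maximal_independent_subset by metis
  have finB: "finite B"
    using fun_space.independent_span_bound[OF U B(2)] B(1) sub by blast
  obtain F where F: "F \<subseteq> T" "inj_on e F" "B = e ` F"
    using B(1) by (metis subset_image_inj)
  have finF: "finite F" using finB F(2,3) finite_imageD by blast
  have "\<exists>c. \<forall>i<m. \<forall>j<m. A $$ (i, j) = (\<Sum>C\<in>F. c C * C $$ (i, j))" if "A \<in> T" for A
  proof -
    have "e A \<in> fun_space.span B" using B(3) that by blast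
    then obtain u where u: "e A = (\<Sum>b\<in>B. (\<lambda>q. u b * b q))"
      unfolding fun_space.span_finite[OF finB] by blast
    have "A $$ (i, j) = (\<Sum>C\<in>F. u (e C) * C $$ (i, j))" if "i < m" "j < m" for i j
    proof -
      have "A $$ (i, j) = e A (i, j)" using that by (simp add: e_def)
      also have "\<dots> = (\<Sum>C\<in>F. u (e C) * e C (i, j))"
        unfolding u F(3) by (subst sum.reindex[OF F(2)]) (simp add: sum_fun_apply)
      finally show ?thesis using that by (simp add: e_def)
    qed
    then show ?thesis by (intro exI[of _ "\<lambda>C. u (e C)"]) blast
  qed
  then show ?thesis using that finF F(1) by blast
qed

definition common_eigenvector :: "nat \<Rightarrow> 'k::field mat set \<Rightarrow> 'k vec \<Rightarrow> bool" where
  "common_eigenvector m T x \<longleftrightarrow> x \<in> carrier_vec m \<and> (\<forall>A\<in>T. \<exists>c. A *\<^sub>v x = c \<cdot>\<^sub>v x)"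

text \<open>Common eigenvectors span the whole space, stated dually. A common eigenvector of a finite
  subset of \<open>T\<close> that spans the same space of matrices is a common eigenvector of \<open>T\<close>.\<close>

lemma common_eigenvectors_separate:
  fixes T :: "'k::alg_closed_field mat set"
  assumes T: "T \<subseteq> carrier_mat m m"
    and comm: "\<And>A B. A \<in> T \<Longrightarrow> B \<in> T \<Longrightarrow> A * B = B * A"
    and ord: "\<And>A. A \<in> T \<Longrightarrow> \<exists>k. of_nat k \<noteq> (0::'k) \<and> A ^\<^sub>m k = 1\<^sub>m m"
    and a: "a \<in> carrier_vec m" and a0: "a \<noteq> 0\<^sub>v m"
  obtains x where "common_eigenvector m T x" "a \<bullet> x \<noteq> 0"
proof -
  obtain F where F: "finite F" "F \<subseteq> T"
    "\<And>A. A \<in> T \<Longrightarrow> \<exists>c. \<forall>i<m. \<forall>j<m. A $$ (i, j) = (\<Sum>B\<in>F. c B * B $$ (i, j))"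
    using matrices_finite_span[of T m] by metis
  obtain i where i: "i < m" "a $ i \<noteq> 0" using a a0
    by (metis carrier_vecD eq_vecI index_zero_vec(1) index_zero_vec(2))
  have "a \<bullet> unit_vec m i \<noteq> 0" using a i by simp
  then obtain x where x: "x \<in> carrier_vec m" "a \<bullet> x \<noteq> 0" "\<forall>A\<in>F. \<exists>c. A *\<^sub>v x = c \<cdot>\<^sub>v x"
    using finite_common_eigenvector[OF F(1) _ _ _ a, of "unit_vec m i"] F(2) T comm ord
    by (metis subset_iff unit_vec_carrier)
  obtain d where d: "\<And>B. B \<in> F \<Longrightarrow> B *\<^sub>v x = d B \<cdot>\<^sub>v x" using x(3) by metis
  have "\<exists>c. A *\<^sub>v x = c \<cdot>\<^sub>v x" if A: "A \<in> T" for A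
  proof -
    obtain c where c: "\<And>i j. i < m \<Longrightarrow> j < m \<Longrightarrow> A $$ (i, j) = (\<Sum>B\<in>F. c B * B $$ (i, j))"
      using F(3)[OF A] by blast
    have dim: "dim_row B = m" "dim_col B = m" if "B \<in> T" for B using T that by auto
    have dB: "(\<Sum>j<m. B $$ (i, j) * x $ j) = d B * x $ i" if "B \<in> F" "i < m" for B i
      using arg_cong[OF d[OF that(1)], of "\<lambda>v. v $ i"] that(2) x(1) dim[of B] F(2) that(1)
      by (auto simp: scalar_prod_def lessThan_atLeast0)
    have "A *\<^sub>v x = (\<Sum>B\<in>F. c B * d B) \<cdot>\<^sub>v x"
    proof (rule eq_vecI)
      fix i assume "i < dim_vec ((\<Sum>B\<in>F. c B * d B) \<cdot>\<^sub>v x)"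
      then have i: "i < m" using x(1) by simp
      have "(A *\<^sub>v x) $ i = (\<Sum>j<m. (\<Sum>B\<in>F. c B * B $$ (i, j)) * x $ j)"
        using i x(1) dim[OF A] by (simp add: scalar_prod_def lessThan_atLeast0 c)
      also have "\<dots> = (\<Sum>B\<in>F. c B * (\<Sum>j<m. B $$ (i, j) * x $ j))"
        unfolding sum_distrib_left sum_distrib_right by (subst sum.swap) (simp add: mult.assoc)
      also have "\<dots> = (\<Sum>B\<in>F. c B * (d B * x $ i))"
        by (rule sum.cong[OF refl]) (simp add: dB i)
      also have "\<dots> = ((\<Sum>B\<in>F. c B * d B) \<cdot>\<^sub>v x) $ i"
        using i x(1) by (simp add: sum_distrib_right mult.assoc)
      finally show "(A *\<^sub>v x) $ i = ((\<Sum>B\<in>F. c B * d B) \<cdot>\<^sub>v x) $ i" .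
    qed (use x(1) dim[OF A] in simp)
    then show ?thesis by blast
  qed
  then show ?thesis using that x(1,2) unfolding common_eigenvector_def by blast
qed

section \<open>The symplectic group and its form\<close>

lemma square_mult_carrier [simp]:
  "A \<in> carrier_mat m m \<Longrightarrow> B \<in> carrier_mat m m \<Longrightarrow> A * B \<in> carrier_mat m m"
  by (rule mult_carrier_mat)

lemma square_mult_assoc:
  fixes A :: "'a::semiring_0 mat"
  shows "A \<in> carrier_mat m m \<Longrightarrow> B \<in> carrier_mat m m \<Longrightarrow> C \<in> carrier_mat m m
    \<Longrightarrow> (A * B) * C = A * (B * C)"
  by (rule assoc_mult_mat)

text \<open>The basis vector with index \<open>dual_index n i\<close> is the partner of the \<open>i\<close>-th one in its hyperbolic
  pair.\<close>

definition dual_index :: "nat \<Rightarrow> nat \<Rightarrow> nat" where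
  "dual_index n i = (if i < n then i + n else i - n)"

lemma dual_index_less: "i < 2 * n \<Longrightarrow> dual_index n i < 2 * n"
  and dual_index_dual_index: "i < 2 * n \<Longrightarrow> dual_index n (dual_index n i) = i"
  by (auto simp: dual_index_def)

lemma symplectic_form_carrier [simp]: "symplectic_form n \<in> carrier_mat (2 * n) (2 * n)"
  by (simp add: symplectic_form_def mult_2)

lemma symplectic_form_dim [simp]:
  "dim_row (symplectic_form n) = 2 * n" "dim_col (symplectic_form n) = 2 * n"
  by (rule carrier_matD[OF symplectic_form_carrier])+

lemma symplectic_form_index:
  assumes "i < 2 * n" "j < 2 * n"
  shows "symplectic_form n $$ (i, j) =
    (if j = dual_index n i then if i < n then 1 else - 1 else 0)"
  using assms by (auto simp: symplectic_form_def dual_index_def)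

lemma symplectic_form_square: "symplectic_form n * symplectic_form n = - 1\<^sub>m (2 * n)"
proof (rule eq_matI)
  fix i j assume "i < dim_row (- 1\<^sub>m (2 * n) :: 'a mat)" "j < dim_col (- 1\<^sub>m (2 * n) :: 'a mat)"
  then have ij: "i < 2 * n" "j < 2 * n" by auto
  let ?J = "symplectic_form n :: 'a mat"
  have "(?J * ?J) $$ (i, j) = (\<Sum>l<2 * n. ?J $$ (i, l) * ?J $$ (l, j))"
    using ij by (simp add: scalar_prod_def lessThan_atLeast0)
  also have "\<dots> = (\<Sum>l<2 * n. if l = dual_index n i then (if i < n then 1 else - 1) * ?J $$ (l, j) else 0)"
    by (rule sum.cong[OF refl]) (use ij in \<open>auto simp: symplectic_form_index\<close>)
  also have "\<dots> = (if i < n then 1 else - 1) * ?J $$ (dual_index n i, j)"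
    using dual_index_less[OF ij(1)] by simp
  also have "\<dots> = (- 1\<^sub>m (2 * n)) $$ (i, j)"
    using ij dual_index_less[OF ij(1)] dual_index_dual_index[OF ij(1)]
    by (auto simp: symplectic_form_index dual_index_def)
  finally show "(?J * ?J) $$ (i, j) = (- 1\<^sub>m (2 * n)) $$ (i, j)" .
qed auto

lemma carrier_GL: "carrier (GL m) = {A \<in> carrier_mat m m. det A \<noteq> 0}"
proof -
  have "A \<in> Units (ring_mat TYPE('a) m ()) \<longleftrightarrow> A \<in> carrier_mat m m \<and> det A \<noteq> 0" for A :: "'a mat"
    using unit_imp_det_non_zero[of A m "()"] det_non_zero_imp_unit[of A m "()"]
    by (auto simp: Units_def ring_mat_def)
  then show ?thesis by (auto simp: GL_def units_of_def)
qed

lemma mult_GL [simp]: "monoid.mult (GL m) = (*)" and one_GL [simp]: "one (GL m) = 1\<^sub>m m"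
  by (auto simp: GL_def units_of_def ring_mat_def)

lemma group_GL: "group (GL m)"
  unfolding GL_def by (rule monoid.units_group[OF ring.is_monoid[OF ring_mat]])

text \<open>As \<open>J\<^sup>2 = -1\<close>, the relation \<open>A\<^sup>T J A = J\<close> exhibits \<open>- J A\<^sup>T J\<close> as an inverse of \<open>A\<close>.\<close>

lemma preserves_form_left_inverse:
  fixes A :: "'k::field mat"
  assumes A: "A \<in> carrier_mat (2 * n) (2 * n)"
    and form: "transpose_mat A * symplectic_form n * A = symplectic_form n"
  shows "(- (symplectic_form n * (transpose_mat A * symplectic_form n))) * A = 1\<^sub>m (2 * n)"
proof -
  let ?J = "symplectic_form n :: 'k mat"
  have At: "transpose_mat A \<in> carrier_mat (2 * n) (2 * n)" using A by simp
  have "(?J * (transpose_mat A * ?J)) * A = ?J * (transpose_mat A * ?J * A)"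
    using assoc_mult_mat[OF symplectic_form_carrier mult_carrier_mat[OF At symplectic_form_carrier] A] .
  also have "\<dots> = - 1\<^sub>m (2 * n)" by (simp only: form symplectic_form_square)
  finally have "(?J * (transpose_mat A * ?J)) * A = - 1\<^sub>m (2 * n)" .
  then show ?thesis using A At by (simp add: uminus_mult_left_mat)
qed

text \<open>The left inverse \<open>- J A\<^sup>T J\<close> is also a right inverse, which gives \<open>A J A\<^sup>T = J\<close>. This version
  suits matrices that are described by their rows.\<close>

lemma preserves_form_transpose:
  fixes A :: "'k::field mat"
  assumes A: "A \<in> carrier_mat (2 * n) (2 * n)"
    and form: "transpose_mat A * symplectic_form n * A = symplectic_form n"
  shows "A * symplectic_form n * transpose_mat A = symplectic_form n"
proof -
  let ?J = "symplectic_form n :: 'k mat"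
  let ?B = "transpose_mat A"
  have B: "?B \<in> carrier_mat (2 * n) (2 * n)" using A by simp
  have JBJ: "?J * (?B * ?J) \<in> carrier_mat (2 * n) (2 * n)" using B by simp
  have "A * (- (?J * (?B * ?J))) = 1\<^sub>m (2 * n)"
    by (rule mat_mult_left_right_inverse[OF _ A preserves_form_left_inverse[OF A form]])
       (use JBJ in simp)
  then have "- (A * (?J * (?B * ?J))) = 1\<^sub>m (2 * n)" using A JBJ by (simp add: uminus_mult_right_mat)
  then have "A * (?J * (?B * ?J)) = - 1\<^sub>m (2 * n)" by (metis uminus_uminus_mat)
  then have eq: "(A * ?J * ?B) * ?J = - 1\<^sub>m (2 * n)"
    using A B by (simp add: square_mult_assoc[of _ "2 * n"])
  have AJB: "A * ?J * ?B \<in> carrier_mat (2 * n) (2 * n)" using A B by simp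
  have "(A * ?J * ?B) * (?J * ?J) = - 1\<^sub>m (2 * n) * ?J"
    using assoc_mult_mat[OF AJB symplectic_form_carrier symplectic_form_carrier] eq by simp
  moreover have "(A * ?J * ?B) * (- 1\<^sub>m (2 * n)) = - ((A * ?J * ?B) * 1\<^sub>m (2 * n))"
    by (rule uminus_mult_right_mat) (use AJB in auto)
  moreover have "- 1\<^sub>m (2 * n) * ?J = - (1\<^sub>m (2 * n) * ?J)"
    by (rule uminus_mult_left_mat) auto
  ultimately have "- (A * ?J * ?B) = - ?J"
    by (simp add: symplectic_form_square right_mult_one_mat[OF AJB])
  then show ?thesis by (metis uminus_uminus_mat)
qed

lemma Sp_iff:
  "A \<in> Sp n \<longleftrightarrow> A \<in> carrier_mat (2 * n) (2 * n) \<and>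
     transpose_mat A * symplectic_form n * A = symplectic_form n" (is "_ \<longleftrightarrow> ?R")
proof
  assume R: ?R
  let ?L = "- (symplectic_form n * (transpose_mat A * symplectic_form n))"
  have L: "?L \<in> carrier_mat (2 * n) (2 * n)" using R by simp
  have "det ?L * det A = 1"
    using preserves_form_left_inverse[of A n] R det_mult[OF L, of A] by simp
  then have "det A \<noteq> 0" by auto
  then show "A \<in> Sp n" using R by (simp add: Sp_def carrier_GL)
qed (simp add: Sp_def carrier_GL)

lemma Sp_iff_transpose:
  "A \<in> Sp n \<longleftrightarrow> A \<in> carrier_mat (2 * n) (2 * n) \<and>
     A * symplectic_form n * transpose_mat A = symplectic_form n"
  using preserves_form_transpose[of A n] preserves_form_transpose[of "transpose_mat A" n]
  by (auto simp: Sp_iff)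

lemma Sp_carrier: "A \<in> Sp n \<Longrightarrow> A \<in> carrier_mat (2 * n) (2 * n)"
  by (simp add: Sp_iff)

lemma Sp_subgroup: "subgroup (Sp n :: 'k::field mat set) (GL (2 * n))"
proof -
  interpret G: group "GL (2 * n) :: 'k mat monoid" by (rule group_GL)
  let ?J = "symplectic_form n :: 'k mat"
  show ?thesis
  proof (rule G.subgroupI)
    show "Sp n \<subseteq> carrier (GL (2 * n))" by (auto simp: Sp_def)
    have "1\<^sub>m (2 * n) \<in> Sp n" by (simp add: Sp_iff)
    then show "Sp n \<noteq> {}" by blast
  next
    fix A :: "'k mat" assume A: "A \<in> Sp n"
    then have AG: "A \<in> carrier (GL (2 * n))" by (simp add: Sp_def)
    define B where "B = inv\<^bsub>GL (2 * n)\<^esub> A"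
    have B: "B \<in> carrier_mat (2 * n) (2 * n)" using G.inv_closed[OF AG] by (simp add: B_def carrier_GL)
    have AB: "A * B = 1\<^sub>m (2 * n)" using G.r_inv[OF AG] by (simp add: B_def)
    have Ac: "A \<in> carrier_mat (2 * n) (2 * n)" using A by (rule Sp_carrier)
    have tAB: "transpose_mat B * transpose_mat A = 1\<^sub>m (2 * n)"
      using transpose_mult[OF Ac B] AB by simp
    have "transpose_mat B * ?J * B = transpose_mat B * (transpose_mat A * ?J * A) * B"
      using A by (simp add: Sp_iff)
    also have "\<dots> = (transpose_mat B * transpose_mat A) * ?J * (A * B)"
      using Ac B by (simp add: square_mult_assoc[of _ "2 * n"])
    also have "\<dots> = ?J" by (simp add: AB tAB)
    finally show "inv\<^bsub>GL (2 * n)\<^esub> A \<in> Sp n" using B by (simp add: Sp_iff B_def)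
  next
    fix A B :: "'k mat" assume AB: "A \<in> Sp n" "B \<in> Sp n"
    then have c: "A \<in> carrier_mat (2 * n) (2 * n)" "B \<in> carrier_mat (2 * n) (2 * n)"
      by (auto dest: Sp_carrier)
    have "transpose_mat (A * B) * ?J * (A * B) = transpose_mat B * (transpose_mat A * ?J * A) * B"
      using c by (simp add: transpose_mult[OF c] square_mult_assoc[of _ "2 * n"])
    also have "\<dots> = ?J" using AB by (simp add: Sp_iff)
    finally show "A \<otimes>\<^bsub>GL (2 * n)\<^esub> B \<in> Sp n" using c by (simp add: Sp_iff)
  qed
qed

lemma group_Sp: "group (matrix_group (2 * n) (Sp n))"
  using group.subgroup_imp_group[OF group_GL Sp_subgroup] .

text \<open>The bilinear form of the matrix \<open>symplectic_form n\<close> (see \<open>sform_eq_form\<close>).\<close>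

definition sform :: "nat \<Rightarrow> 'k::field vec \<Rightarrow> 'k vec \<Rightarrow> 'k" where
  "sform n x y = (\<Sum>i<n. x $ i * y $ (i + n) - x $ (i + n) * y $ i)"

text \<open>The vector that represents the functional \<open>sform n x\<close> with respect to the standard scalar
  product.\<close>

definition form_covector :: "nat \<Rightarrow> 'k::field vec \<Rightarrow> 'k vec" where
  "form_covector n x = vec (2 * n) (\<lambda>i. if i < n then - x $ (i + n) else x $ (i - n))"

lemma form_covector_carrier [simp]: "form_covector n x \<in> carrier_vec (2 * n)"
  by (simp add: form_covector_def)

lemma sum_lessThan_double: "(\<Sum>i<2 * n. f i) = (\<Sum>i<n. f i + f (i + n))"
  for f :: "nat \<Rightarrow> 'a::comm_monoid_add"
proof -
  have "(\<Sum>i<n + k. f i) = (\<Sum>i<n. f i) + (\<Sum>i<k. f (i + n))" for k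
    by (induction k) (auto simp: add_ac)
  from this[of n] show ?thesis by (simp add: mult_2 sum.distrib)
qed

lemma form_covector_dot:
  assumes "y \<in> carrier_vec (2 * n)"
  shows "form_covector n x \<bullet> y = sform n x y"
proof -
  have "form_covector n x \<bullet> y = (\<Sum>i<2 * n. form_covector n x $ i * y $ i)"
    using assms by (simp add: scalar_prod_def lessThan_atLeast0)
  also have "\<dots> = sform n x y"
    unfolding sum_lessThan_double sform_def
    by (rule sum.cong[OF refl]) (auto simp: form_covector_def)
  finally show ?thesis .
qed

lemma form_covector_eq_0_iff:
  assumes "x \<in> carrier_vec (2 * n)"
  shows "form_covector n x = 0\<^sub>v (2 * n) \<longleftrightarrow> x = 0\<^sub>v (2 * n)"
proof
  assume L: "form_covector n x = 0\<^sub>v (2 * n)"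
  have "x $ i = 0" if "i < 2 * n" for i
  proof (cases "i < n")
    case True
    then show ?thesis using arg_cong[OF L, of "\<lambda>u. u $ (i + n)"] by (simp add: form_covector_def)
  next
    case False
    then have "i - n < n" "i - n < 2 * n" "i - n + n = i" using that by auto
    then show ?thesis using arg_cong[OF L, of "\<lambda>u. u $ (i - n)"] by (simp add: form_covector_def)
  qed
  then show "x = 0\<^sub>v (2 * n)" using assms by (intro eq_vecI) auto
qed (auto simp: form_covector_def)

lemma sform_self [simp]: "sform n x x = 0"
  by (simp add: sform_def mult.commute)

lemma sform_swap: "sform n y x = - sform n x y"
  unfolding sform_def by (subst sum_negf[symmetric], rule sum.cong) (simp_all add: mult.commute)

lemma sform_add_right:
  assumes "y \<in> carrier_vec (2 * n)" "z \<in> carrier_vec (2 * n)"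
  shows "sform n x (y + z) = sform n x y + sform n x z"
  unfolding sform_def sum.distrib[symmetric]
  by (rule sum.cong[OF refl]) (use assms in \<open>simp add: algebra_simps\<close>)

lemma sform_smult_right:
  assumes "y \<in> carrier_vec (2 * n)"
  shows "sform n x (c \<cdot>\<^sub>v y) = c * sform n x y"
  unfolding sform_def sum_distrib_left
  by (rule sum.cong[OF refl]) (use assms in \<open>simp add: algebra_simps\<close>)

lemma sform_smult_left:
  assumes "x \<in> carrier_vec (2 * n)"
  shows "sform n (c \<cdot>\<^sub>v x) y = c * sform n x y"
  unfolding sform_def sum_distrib_left
  by (rule sum.cong[OF refl]) (use assms in \<open>simp add: algebra_simps\<close>)

lemma sform_eq_form:
  assumes x: "x \<in> carrier_vec (2 * n)" and y: "y \<in> carrier_vec (2 * n)"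
  shows "sform n x y = x \<bullet> (symplectic_form n *\<^sub>v y)"
proof -
  have "(symplectic_form n *\<^sub>v y) $ i = (if i < n then y $ (i + n) else - y $ (i - n))"
    if i: "i < 2 * n" for i
  proof -
    have "(symplectic_form n *\<^sub>v y) $ i = (\<Sum>j<2 * n. symplectic_form n $$ (i, j) * y $ j)"
      using i y by (simp add: scalar_prod_def lessThan_atLeast0)
    also have "\<dots> = (\<Sum>j<2 * n. if j = dual_index n i then (if i < n then 1 else - 1) * y $ j else 0)"
      by (rule sum.cong[OF refl]) (use i in \<open>auto simp: symplectic_form_index\<close>)
    finally show ?thesis using dual_index_less[OF i] by (auto simp: dual_index_def)
  qed
  then have "x \<bullet> (symplectic_form n *\<^sub>v y)
      = (\<Sum>i<2 * n. x $ i * (if i < n then y $ (i + n) else - y $ (i - n)))"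
    unfolding scalar_prod_def lessThan_atLeast0 by (intro sum.cong) auto
  also have "\<dots> = sform n x y"
    unfolding sum_lessThan_double sform_def by (rule sum.cong) auto
  finally show ?thesis ..
qed

lemma sform_invariant:
  assumes A: "A \<in> Sp n" and x: "x \<in> carrier_vec (2 * n)" and y: "y \<in> carrier_vec (2 * n)"
  shows "sform n (A *\<^sub>v x) (A *\<^sub>v y) = sform n x y"
proof -
  let ?J = "symplectic_form n"
  have Ac: "A \<in> carrier_mat (2 * n) (2 * n)" using A by (rule Sp_carrier)
  then have At: "transpose_mat A \<in> carrier_mat (2 * n) (2 * n)" by simp
  have Ay: "A *\<^sub>v y \<in> carrier_vec (2 * n)" using Ac y by simp
  then have JAy: "?J *\<^sub>v (A *\<^sub>v y) \<in> carrier_vec (2 * n)"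
    by (rule mult_mat_vec_carrier[OF symplectic_form_carrier])
  have "sform n (A *\<^sub>v x) (A *\<^sub>v y) = (A *\<^sub>v x) \<bullet> (?J *\<^sub>v (A *\<^sub>v y))"
    using Ac x Ay by (simp add: sform_eq_form)
  also have "\<dots> = x \<bullet> (transpose_mat A *\<^sub>v (?J *\<^sub>v (A *\<^sub>v y)))"
    using transpose_vec_mult_scalar[of "transpose_mat A" "2*n" "2*n" "?J *\<^sub>v (A *\<^sub>v y)" x] At JAy x by simp
  also have "transpose_mat A *\<^sub>v (?J *\<^sub>v (A *\<^sub>v y)) = (transpose_mat A * ?J * A) *\<^sub>v y"
    using Ac At y Ay
    by (simp add: assoc_mult_mat_vec[of _ "2*n" "2*n" _ "2*n"] mult_carrier_mat[OF At symplectic_form_carrier])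
  also have "\<dots> = ?J *\<^sub>v y" using A by (simp add: Sp_iff)
  finally show ?thesis using x y by (simp add: sform_eq_form)
qed

section \<open>Symplectic bases of common eigenvectors\<close>

definition symplectic_family :: "nat \<Rightarrow> nat \<Rightarrow> (nat \<Rightarrow> 'k::field vec) \<Rightarrow> (nat \<Rightarrow> 'k vec) \<Rightarrow> bool" where
  "symplectic_family n k v w \<longleftrightarrow> (\<forall>i<k. \<forall>j<k. sform n (v i) (v j) = 0 \<and> sform n (w i) (w j) = 0 \<and>
     sform n (v i) (w j) = (if i = j then 1 else 0))"

lemma common_eigenvector_carrier: "common_eigenvector m T x \<Longrightarrow> x \<in> carrier_vec m"
  by (simp add: common_eigenvector_def)

lemma common_eigenvectorE:
  assumes "common_eigenvector m T x" "A \<in> T"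
  obtains c where "A *\<^sub>v x = c \<cdot>\<^sub>v x"
  using assms unfolding common_eigenvector_def by blast

lemma common_eigenvector_smult:
  assumes T: "T \<subseteq> carrier_mat m m" and x: "common_eigenvector m T x"
  shows "common_eigenvector m T (c \<cdot>\<^sub>v x)"
  unfolding common_eigenvector_def
proof (intro conjI ballI)
  show "c \<cdot>\<^sub>v x \<in> carrier_vec m" using x by (simp add: common_eigenvector_def)
  fix A assume A: "A \<in> T"
  then obtain a where a: "A *\<^sub>v x = a \<cdot>\<^sub>v x" using x by (auto simp: common_eigenvector_def)
  have "A *\<^sub>v (c \<cdot>\<^sub>v x) = c \<cdot>\<^sub>v (A *\<^sub>v x)"
    using mult_mat_vec[of A m m x c] A T x by (auto simp: common_eigenvector_def)
  also have "\<dots> = a \<cdot>\<^sub>v (c \<cdot>\<^sub>v x)" by (simp add: a smult_smult_assoc mult.commute)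
  finally show "\<exists>a. A *\<^sub>v (c \<cdot>\<^sub>v x) = a \<cdot>\<^sub>v (c \<cdot>\<^sub>v x)" by blast
qed

text \<open>Let \<open>v, w\<close> be a hyperbolic pair of common eigenvectors. Their weights are inverse to each
  other, and the weight of \<open>x\<close> is inverse to that of \<open>v\<close> unless \<open>x\<close> is orthogonal to \<open>v\<close>; similarly
  for \<open>w\<close>. So subtracting from \<open>x\<close> its component in the plane of \<open>v\<close> and \<open>w\<close> only involves vectors
  of the same weight as \<open>x\<close> and yields a common eigenvector again.\<close>

lemma orthogonalize_pair:
  fixes T :: "'k::field mat set"
  assumes T: "T \<subseteq> Sp n" and v: "common_eigenvector (2 * n) T v" and w: "common_eigenvector (2 * n) T w"
    and vw: "sform n v w = 1" and x: "common_eigenvector (2 * n) T x"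
  obtains y where "common_eigenvector (2 * n) T y" "sform n v y = 0" "sform n w y = 0"
    "\<And>u. sform n u v = 0 \<Longrightarrow> sform n u w = 0 \<Longrightarrow> sform n u y = sform n u x"
proof -
  define y where "y = x + ((- sform n v x) \<cdot>\<^sub>v w + sform n w x \<cdot>\<^sub>v v)"
  have c: "v \<in> carrier_vec (2 * n)" "w \<in> carrier_vec (2 * n)" "x \<in> carrier_vec (2 * n)"
    using v w x by (auto dest: common_eigenvector_carrier)
  have yc: "y \<in> carrier_vec (2 * n)" using c by (simp add: y_def)
  have form: "sform n u y = sform n u x - sform n v x * sform n u w + sform n w x * sform n u v" for u
    using c by (simp add: y_def sform_add_right sform_smult_right)
  have "\<exists>d. A *\<^sub>v y = d \<cdot>\<^sub>v y" if A: "A \<in> T" for A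
  proof -
    obtain a b d where e: "A *\<^sub>v v = a \<cdot>\<^sub>v v" "A *\<^sub>v w = b \<cdot>\<^sub>v w" "A *\<^sub>v x = d \<cdot>\<^sub>v x"
      using common_eigenvectorE[OF v A] common_eigenvectorE[OF w A] common_eigenvectorE[OF x A]
      by metis
    have ASp: "A \<in> Sp n" using A T by blast
    then have Ac: "A \<in> carrier_mat (2 * n) (2 * n)" by (rule Sp_carrier)
    have inv: "sform n (A *\<^sub>v p) (A *\<^sub>v q) = sform n p q"
      if "p \<in> carrier_vec (2 * n)" "q \<in> carrier_vec (2 * n)" for p q
      using sform_invariant[OF ASp that] .
    have scale: "sform n (s \<cdot>\<^sub>v p) (t \<cdot>\<^sub>v q) = s * t * sform n p q"
      if "p \<in> carrier_vec (2 * n)" "q \<in> carrier_vec (2 * n)" for s t p q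
      using that by (simp add: sform_smult_left[OF that(1)] sform_smult_right[OF that(2)])
    have ab: "a * b = 1"
      using inv[OF c(1,2)] unfolding e scale[OF c(1,2)] vw by simp
    have ad: "a * d * sform n v x = sform n v x"
      using inv[OF c(1,3)] unfolding e scale[OF c(1,3)] .
    have bd: "b * d * sform n w x = sform n w x"
      using inv[OF c(2,3)] unfolding e scale[OF c(2,3)] .
    have wt: "b * sform n v x = d * sform n v x" "a * sform n w x = d * sform n w x"
    proof -
      have "b * sform n v x = b * (a * d * sform n v x)" by (simp only: ad)
      also have "\<dots> = (a * b) * (d * sform n v x)" by (simp add: ac_simps)
      finally show "b * sform n v x = d * sform n v x" by (simp add: ab)
      have "a * sform n w x = a * (b * d * sform n w x)" by (simp only: bd)
      also have "\<dots> = (a * b) * (d * sform n w x)" by (simp add: ac_simps)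
      finally show "a * sform n w x = d * sform n w x" by (simp add: ab)
    qed
    have "A *\<^sub>v y = A *\<^sub>v x + (A *\<^sub>v ((- sform n v x) \<cdot>\<^sub>v w) + A *\<^sub>v (sform n w x \<cdot>\<^sub>v v))"
      unfolding y_def using Ac c by (simp add: mult_add_distrib_mat_vec[of _ "2*n" "2*n"])
    also have "\<dots> = d \<cdot>\<^sub>v x + ((- sform n v x) \<cdot>\<^sub>v (b \<cdot>\<^sub>v w) + sform n w x \<cdot>\<^sub>v (a \<cdot>\<^sub>v v))"
      using mult_mat_vec[OF Ac c(1)] mult_mat_vec[OF Ac c(2)] by (simp add: e)
    also have "\<dots> = d \<cdot>\<^sub>v y"
    proof (rule eq_vecI)
      fix i assume "i < dim_vec (d \<cdot>\<^sub>v y)"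
      then have i: "i < 2 * n" using yc by simp
      have "(d \<cdot>\<^sub>v x + ((- sform n v x) \<cdot>\<^sub>v (b \<cdot>\<^sub>v w) + sform n w x \<cdot>\<^sub>v (a \<cdot>\<^sub>v v))) $ i
          = d * x $ i + (- (b * sform n v x) * w $ i + (a * sform n w x) * v $ i)"
        using i c by (simp add: ac_simps)
      also have "\<dots> = (d \<cdot>\<^sub>v y) $ i"
        unfolding wt using i c by (simp add: y_def algebra_simps)
      finally show "(d \<cdot>\<^sub>v x + ((- sform n v x) \<cdot>\<^sub>v (b \<cdot>\<^sub>v w) + sform n w x \<cdot>\<^sub>v (a \<cdot>\<^sub>v v))) $ i = (d \<cdot>\<^sub>v y) $ i" .
    qed (use c yc in auto)
    finally show ?thesis by blast
  qed
  then have "common_eigenvector (2 * n) T y" using yc by (simp add: common_eigenvector_def)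
  moreover have "sform n v y = 0" by (simp add: form vw)
  moreover have "sform n w y = 0" by (simp add: form sform_swap[of n w v] vw)
  ultimately show ?thesis using that form by simp
qed

text \<open>Pairing with a vector that is orthogonal to the family is not changed. This is how the
  construction of the next pair knows that the result is nonzero.\<close>

lemma orthogonalize:
  fixes T :: "'k::field mat set"
  assumes T: "T \<subseteq> Sp n" and x: "common_eigenvector (2 * n) T x"
    and "\<And>i. i < k \<Longrightarrow> common_eigenvector (2 * n) T (v i)"
    and "\<And>i. i < k \<Longrightarrow> common_eigenvector (2 * n) T (w i)"
    and "symplectic_family n k v w"
  shows "\<exists>y. common_eigenvector (2 * n) T y \<and> (\<forall>i<k. sform n (v i) y = 0 \<and> sform n (w i) y = 0) \<and>
    (\<forall>u. (\<forall>i<k. sform n u (v i) = 0 \<and> sform n u (w i) = 0) \<longrightarrow> sform n u y = sform n u x)"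
  using assms(3-5)
proof (induction k)
  case 0
  show ?case using x by auto
next
  case (Suc k)
  have fam: "symplectic_family n k v w" using Suc.prems(3) by (simp add: symplectic_family_def)
  obtain y where y: "common_eigenvector (2 * n) T y"
    "\<forall>i<k. sform n (v i) y = 0 \<and> sform n (w i) y = 0"
    "\<forall>u. (\<forall>i<k. sform n u (v i) = 0 \<and> sform n u (w i) = 0) \<longrightarrow> sform n u y = sform n u x"
    using Suc.IH[OF Suc.prems(1,2) fam] by auto
  have vw: "sform n (v k) (w k) = 1" using Suc.prems(3) by (simp add: symplectic_family_def)
  obtain y' where y': "common_eigenvector (2 * n) T y'" "sform n (v k) y' = 0" "sform n (w k) y' = 0"
    "\<And>u. sform n u (v k) = 0 \<Longrightarrow> sform n u (w k) = 0 \<Longrightarrow> sform n u y' = sform n u y"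
    using orthogonalize_pair[OF T Suc.prems(1)[OF lessI] Suc.prems(2)[OF lessI] vw y(1)] by metis
  have 1: "sform n (v i) y' = 0 \<and> sform n (w i) y' = 0" if "i < Suc k" for i
  proof (cases "i = k")
    case False
    then have i: "i < k" using that by simp
    have "sform n (v i) (v k) = 0" "sform n (v i) (w k) = 0" "sform n (w i) (w k) = 0"
      "sform n (v k) (w i) = 0"
      using Suc.prems(3) i by (auto simp: symplectic_family_def)
    moreover from this have "sform n (w i) (v k) = 0" by (metis sform_swap neg_equal_0_iff_equal)
    ultimately show ?thesis using y'(4) y(2) i by simp
  qed (use y' in simp)
  show ?case using y'(1,4) 1 y(3) by (intro exI[of _ y']) auto
qed

text \<open>A homogeneous linear system with \<open>2 * k\<close> equations in \<open>2 * n\<close> unknowns, padded with zero rows to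
  a square system.\<close>

lemma ex_orthogonal_vector:
  fixes v w :: "nat \<Rightarrow> 'k::field vec"
  assumes k: "k < n"
  obtains z where "z \<in> carrier_vec (2 * n)" "z \<noteq> 0\<^sub>v (2 * n)"
    "\<And>i. i < k \<Longrightarrow> sform n (v i) z = 0 \<and> sform n (w i) z = 0"
proof -
  define r where "r i = (if i < k then form_covector n (v i)
    else if i < 2 * k then form_covector n (w (i - k)) else 0\<^sub>v (2 * n))" for i
  have rc: "r i \<in> carrier_vec (2 * n)" for i by (simp add: r_def)
  define M where "M = mat (2 * n) (2 * n) (\<lambda>(i, j). r i $ j)"
  have M: "M \<in> carrier_mat (2 * n) (2 * n)" by (simp add: M_def)
  have row: "row M i = r i" if "i < 2 * n" for i
    using that rc[of i] by (intro eq_vecI) (auto simp: M_def)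
  let ?l = "2 * n - 1"
  have l: "?l < 2 * n" "\<not> ?l < k" "\<not> ?l < 2 * k" using k by auto
  let ?e = "unit_vec (2 * n) ?l :: 'k vec"
  have "transpose_mat M *\<^sub>v ?e = 0\<^sub>v (2 * n)"
  proof (rule eq_vecI)
    fix j assume "j < dim_vec (0\<^sub>v (2 * n) :: 'k vec)"
    then have j: "j < 2 * n" by simp
    have "(transpose_mat M *\<^sub>v ?e) $ j = col M j \<bullet> ?e" using j M by simp
    also have "\<dots> = M $$ (?l, j)" using j l M by simp
    also have "\<dots> = 0" using j l by (simp add: M_def r_def)
    finally show "(transpose_mat M *\<^sub>v ?e) $ j = 0\<^sub>v (2 * n) $ j" using j by simp
  qed (use M in simp)
  moreover have "?e \<noteq> 0\<^sub>v (2 * n)" using l(1) by simp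
  ultimately have "det (transpose_mat M) = 0"
    using det_0_iff_vec_prod_zero[of "transpose_mat M" "2 * n"] M unit_vec_carrier
    by (metis transpose_carrier_mat)
  then have "det M = 0" using det_transpose[OF M] by simp
  then obtain z where z: "z \<in> carrier_vec (2 * n)" "z \<noteq> 0\<^sub>v (2 * n)" "M *\<^sub>v z = 0\<^sub>v (2 * n)"
    using det_0_iff_vec_prod_zero[OF M] by blast
  have dot: "r i \<bullet> z = 0" if "i < 2 * n" for i
    using arg_cong[OF z(3), of "\<lambda>u. u $ i"] that M row[OF that] by simp
  have "sform n (v i) z = 0 \<and> sform n (w i) z = 0" if i: "i < k" for i
    using dot[of i] dot[of "i + k"] i k form_covector_dot[OF z(1)] by (simp add: r_def)
  then show ?thesis using that z(1,2) by blast
qed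

text \<open>Some nonzero vector \<open>z\<close> is orthogonal to the pairs found so far, and some common eigenvector is
  not orthogonal to \<open>z\<close>. Orthogonalizing the latter gives \<open>x\<close>; the same step with \<open>x\<close> in place of
  \<open>z\<close> gives a partner of \<open>x\<close>, which is then rescaled.\<close>

lemma symplectic_eigenbasis:
  fixes T :: "'k::alg_closed_field mat set"
  assumes T: "T \<subseteq> Sp n"
    and comm: "\<And>A B. A \<in> T \<Longrightarrow> B \<in> T \<Longrightarrow> A * B = B * A"
    and ord: "\<And>A. A \<in> T \<Longrightarrow> \<exists>k. of_nat k \<noteq> (0::'k) \<and> A ^\<^sub>m k = 1\<^sub>m (2 * n)"
    and "k \<le> n"
  shows "\<exists>v w. (\<forall>i<k. common_eigenvector (2 * n) T (v i) \<and> common_eigenvector (2 * n) T (w i)) \<and>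
    symplectic_family n k v w"
  using \<open>k \<le> n\<close>
proof (induction k)
  case 0
  show ?case by (simp add: symplectic_family_def)
next
  case (Suc k)
  then obtain v w where E: "\<And>i. i < k \<Longrightarrow> common_eigenvector (2 * n) T (v i)"
    "\<And>i. i < k \<Longrightarrow> common_eigenvector (2 * n) T (w i)"
    and fam: "symplectic_family n k v w" by auto
  have Tc: "T \<subseteq> carrier_mat (2 * n) (2 * n)" using T Sp_carrier by blast
  have separate: "\<exists>y. common_eigenvector (2 * n) T y \<and> sform n x y \<noteq> 0 \<and>
      (\<forall>i<k. sform n (v i) y = 0 \<and> sform n (w i) y = 0)"
    if x: "x \<in> carrier_vec (2 * n)" "x \<noteq> 0\<^sub>v (2 * n)"
      and orth: "\<And>i. i < k \<Longrightarrow> sform n (v i) x = 0 \<and> sform n (w i) x = 0" for x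
  proof -
    have "form_covector n x \<noteq> 0\<^sub>v (2 * n)" using x form_covector_eq_0_iff by blast
    then obtain y where y: "common_eigenvector (2 * n) T y" "form_covector n x \<bullet> y \<noteq> 0"
      using common_eigenvectors_separate[OF Tc comm ord form_covector_carrier] by metis
    have "sform n x y \<noteq> 0" using y form_covector_dot common_eigenvector_carrier by metis
    moreover obtain y' where "common_eigenvector (2 * n) T y'"
      "\<forall>i<k. sform n (v i) y' = 0 \<and> sform n (w i) y' = 0"
      "\<forall>u. (\<forall>i<k. sform n u (v i) = 0 \<and> sform n u (w i) = 0) \<longrightarrow> sform n u y' = sform n u y"
      using orthogonalize[OF T y(1) E fam] by blast
    moreover have "\<forall>i<k. sform n x (v i) = 0 \<and> sform n x (w i) = 0"
      using orth by (metis sform_swap neg_equal_0_iff_equal)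
    ultimately show ?thesis by metis
  qed
  obtain z where z: "z \<in> carrier_vec (2 * n)" "z \<noteq> 0\<^sub>v (2 * n)"
    "\<And>i. i < k \<Longrightarrow> sform n (v i) z = 0 \<and> sform n (w i) z = 0"
    using ex_orthogonal_vector[of k n v w] Suc.prems by auto
  obtain x where x: "common_eigenvector (2 * n) T x" "sform n z x \<noteq> 0"
    "\<And>i. i < k \<Longrightarrow> sform n (v i) x = 0 \<and> sform n (w i) x = 0"
    using separate[OF z] by blast
  have "x \<noteq> 0\<^sub>v (2 * n)" using x(2) by (auto simp: sform_def)
  then obtain y where y: "common_eigenvector (2 * n) T y" "sform n x y \<noteq> 0"
    "\<And>i. i < k \<Longrightarrow> sform n (v i) y = 0 \<and> sform n (w i) y = 0"
    using separate[OF common_eigenvector_carrier[OF x(1)] _ x(3)] by blast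
  let ?y = "inverse (sform n x y) \<cdot>\<^sub>v y"
  have yc: "y \<in> carrier_vec (2 * n)" using y(1) by (rule common_eigenvector_carrier)
  have swap: "sform n x (v i) = 0 \<and> sform n x (w i) = 0 \<and> sform n ?y (v i) = 0 \<and> sform n ?y (w i) = 0"
    if "i < k" for i
    using x(3)[OF that] y(3)[OF that]
    by (simp add: sform_smult_left[OF yc] sform_swap[of n x "v i"] sform_swap[of n x "w i"]
      sform_swap[of n y "v i"] sform_swap[of n y "w i"])
  have "symplectic_family n (Suc k) (v(k := x)) (w(k := ?y))"
    unfolding symplectic_family_def
  proof (intro allI impI)
    fix i j assume ij: "i < Suc k" "j < Suc k"
    consider "i < k" "j < k" | "i < k" "j = k" | "i = k" "j < k" | "i = k" "j = k"
      using ij by linarith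
    then show "sform n ((v(k := x)) i) ((v(k := x)) j) = 0 \<and>
        sform n ((w(k := ?y)) i) ((w(k := ?y)) j) = 0 \<and>
        sform n ((v(k := x)) i) ((w(k := ?y)) j) = (if i = j then 1 else 0)"
    proof cases
      case 1
      then show ?thesis using fam by (simp add: symplectic_family_def)
    next
      case 2
      then show ?thesis using x(3) y(3) by (simp add: sform_smult_right[OF yc])
    next
      case 3
      then show ?thesis using swap by simp
    next
      case 4
      then show ?thesis using y(2) by (simp add: sform_smult_right[OF yc])
    qed
  qed
  moreover have "common_eigenvector (2 * n) T ((v(k := x)) i) \<and> common_eigenvector (2 * n) T ((w(k := ?y)) i)"
    if "i < Suc k" for i
    using that E x(1) common_eigenvector_smult[OF Tc y(1)] by (cases "i = k") auto
  ultimately show ?case by blast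
qed

lemma symplectic_diagonalization:
  fixes T :: "'k::alg_closed_field mat set"
  assumes T: "T \<subseteq> Sp n"
    and comm: "\<And>A B. A \<in> T \<Longrightarrow> B \<in> T \<Longrightarrow> A * B = B * A"
    and ord: "\<And>A. A \<in> T \<Longrightarrow> \<exists>k. of_nat k \<noteq> (0::'k) \<and> A ^\<^sub>m k = 1\<^sub>m (2 * n)"
  obtains S where "S \<in> Sp n"
    "\<And>A. A \<in> T \<Longrightarrow> \<exists>D\<in>carrier_mat (2 * n) (2 * n). diagonal_mat D \<and> A * S = S * D"
proof -
  obtain v w where E: "\<And>i. i < n \<Longrightarrow> common_eigenvector (2 * n) T (v i) \<and> common_eigenvector (2 * n) T (w i)"
    and fam: "symplectic_family n n v w"
    using symplectic_eigenbasis[OF T comm ord order_refl] by blast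
  define c where "c j = (if j < n then v j else w (j - n))" for j
  have cE: "common_eigenvector (2 * n) T (c j)" if "j < 2 * n" for j
    using E[of j] E[of "j - n"] that by (auto simp: c_def)
  have cc: "c j \<in> carrier_vec (2 * n)" if "j < 2 * n" for j
    using cE[OF that] by (rule common_eigenvector_carrier)
  define S where "S = mat (2 * n) (2 * n) (\<lambda>(i, j). c j $ i)"
  have Sc: "S \<in> carrier_mat (2 * n) (2 * n)" by (simp add: S_def)
  have col: "col S j = c j" if "j < 2 * n" for j
    using that cc[OF that] by (intro eq_vecI) (auto simp: S_def)
  have "transpose_mat S * symplectic_form n * S = symplectic_form n"
  proof (rule eq_matI)
    fix i j assume "i < dim_row (symplectic_form n :: 'k mat)" "j < dim_col (symplectic_form n :: 'k mat)"
    then have ij: "i < 2 * n" "j < 2 * n" by auto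
    have St: "transpose_mat S \<in> carrier_mat (2 * n) (2 * n)" using Sc by simp
    have "(transpose_mat S * symplectic_form n * S) $$ (i, j) = (transpose_mat S * (symplectic_form n * S)) $$ (i, j)"
      by (simp only: square_mult_assoc[OF St symplectic_form_carrier Sc])
    also have "\<dots> = c i \<bullet> col (symplectic_form n * S) j"
      using ij Sc by (simp add: col)
    also have "col (symplectic_form n * S) j = symplectic_form n *\<^sub>v c j"
      using ij col_mult2[OF symplectic_form_carrier Sc] col by simp
    also have "c i \<bullet> (symplectic_form n *\<^sub>v c j) = sform n (c i) (c j)"
      using sform_eq_form[OF cc cc] ij by simp
    also have "\<dots> = symplectic_form n $$ (i, j)"
      using ij fam sform_swap[of n "w (i - n)" "v j"]
      by (auto simp: c_def symplectic_form_index dual_index_def symplectic_family_def)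
    finally show "(transpose_mat S * symplectic_form n * S) $$ (i, j) = symplectic_form n $$ (i, j)" .
  qed (use Sc in auto)
  then have S: "S \<in> Sp n" using Sc by (simp add: Sp_iff)
  have "\<exists>D\<in>carrier_mat (2 * n) (2 * n). diagonal_mat D \<and> A * S = S * D" if A: "A \<in> T" for A
  proof -
    have Ac: "A \<in> carrier_mat (2 * n) (2 * n)" using A T Sp_carrier by blast
    have "\<forall>j. \<exists>a. j < 2 * n \<longrightarrow> A *\<^sub>v c j = a \<cdot>\<^sub>v c j"
      using common_eigenvectorE[OF cE A] by metis
    then obtain d where d: "\<And>j. j < 2 * n \<Longrightarrow> A *\<^sub>v c j = d j \<cdot>\<^sub>v c j" by metis
    define D where "D = mat (2 * n) (2 * n) (\<lambda>(i, j). if i = j then d j else 0)"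
    have Dc: "D \<in> carrier_mat (2 * n) (2 * n)" by (simp add: D_def)
    have "A * S = S * D"
    proof (rule eq_matI)
      fix i j assume "i < dim_row (S * D)" "j < dim_col (S * D)"
      then have ij: "i < 2 * n" "j < 2 * n" using Sc Dc by auto
      have "(A * S) $$ (i, j) = (A *\<^sub>v c j) $ i" using ij Ac Sc by (simp add: col)
      also have "\<dots> = d j * c j $ i" using d[OF ij(2)] ij carrier_vecD[OF cc[OF ij(2)]] by simp
      also have "\<dots> = (\<Sum>l<2 * n. if l = j then S $$ (i, l) * d j else 0)"
        using ij by (simp add: S_def)
      also have "\<dots> = (\<Sum>l<2 * n. S $$ (i, l) * D $$ (l, j))"
        by (rule sum.cong[OF refl]) (use ij in \<open>auto simp: D_def\<close>)
      also have "\<dots> = (S * D) $$ (i, j)"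
        using ij Sc Dc by (simp add: scalar_prod_def lessThan_atLeast0)
      finally show "(A * S) $$ (i, j) = (S * D) $$ (i, j)" .
    qed (use Ac Sc Dc in auto)
    moreover have "diagonal_mat D" by (simp add: D_def diagonal_mat_def)
    ultimately show ?thesis using Dc by blast
  qed
  then show ?thesis using that S by blast
qed

section \<open>Monomial matrices and the normalizer of the diagonal torus\<close>

text \<open>The entry \<open>a i\<close> in row \<open>i\<close> stands in column \<open>\<pi> i\<close>. With \<open>\<pi> = id\<close> these are the diagonal matrices,
  with \<open>a = 1\<close> the permutation matrices.\<close>

definition monomial_mat :: "nat \<Rightarrow> (nat \<Rightarrow> nat) \<Rightarrow> (nat \<Rightarrow> 'k::field) \<Rightarrow> 'k mat" where
  "monomial_mat m \<pi> a = mat m m (\<lambda>(i, j). if j = \<pi> i then a i else 0)"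

lemma monomial_mat_carrier [simp]: "monomial_mat m \<pi> a \<in> carrier_mat m m"
  by (simp add: monomial_mat_def)

lemma monomial_mat_dim [simp]:
  "dim_row (monomial_mat m \<pi> a) = m" "dim_col (monomial_mat m \<pi> a) = m"
  by (simp_all add: monomial_mat_def)

lemma monomial_mat_index:
  "i < m \<Longrightarrow> j < m \<Longrightarrow> monomial_mat m \<pi> a $$ (i, j) = (if j = \<pi> i then a i else 0)"
  by (simp add: monomial_mat_def)

lemma monomial_mat_cong:
  assumes "\<And>i. i < m \<Longrightarrow> \<pi> i = \<rho> i" "\<And>i. i < m \<Longrightarrow> a i = b i"
  shows "monomial_mat m \<pi> a = monomial_mat m \<rho> b"
  by (rule eq_matI) (use assms in \<open>auto simp: monomial_mat_index\<close>)

lemma one_eq_monomial_mat: "1\<^sub>m m = monomial_mat m id (\<lambda>_. 1)"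
  by (rule eq_matI) (auto simp: monomial_mat_index)

lemma diagonal_eq_monomial_mat:
  assumes "A \<in> carrier_mat m m" "diagonal_mat A"
  shows "A = monomial_mat m id (\<lambda>i. A $$ (i, i))"
  by (rule eq_matI) (use assms in \<open>auto simp: monomial_mat_index diagonal_mat_def\<close>)

lemma diagonal_monomial_mat: "diagonal_mat (monomial_mat m id a)"
  by (auto simp: monomial_mat_index diagonal_mat_def)

lemma monomial_mat_mult_index:
  assumes M: "M \<in> carrier_mat m m" and "\<pi> i < m" "i < m" "j < m"
  shows "(monomial_mat m \<pi> a * M) $$ (i, j) = a i * M $$ (\<pi> i, j)"
proof -
  have "(monomial_mat m \<pi> a * M) $$ (i, j) = (\<Sum>l<m. monomial_mat m \<pi> a $$ (i, l) * M $$ (l, j))"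
    using assms by (simp add: scalar_prod_def lessThan_atLeast0)
  also have "\<dots> = (\<Sum>l<m. if l = \<pi> i then a i * M $$ (l, j) else 0)"
    by (rule sum.cong[OF refl]) (use assms in \<open>auto simp: monomial_mat_index\<close>)
  also have "\<dots> = a i * M $$ (\<pi> i, j)" using assms by simp
  finally show ?thesis .
qed

lemma mult_diagonal_index:
  assumes M: "M \<in> carrier_mat m m" and "i < m" "j < m"
  shows "(M * monomial_mat m id a) $$ (i, j) = M $$ (i, j) * a j"
proof -
  have "(M * monomial_mat m id a) $$ (i, j) = (\<Sum>l<m. M $$ (i, l) * monomial_mat m id a $$ (l, j))"
    using assms by (simp add: scalar_prod_def lessThan_atLeast0)
  also have "\<dots> = (\<Sum>l<m. if l = j then M $$ (i, l) * a l else 0)"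
    by (rule sum.cong[OF refl]) (use assms in \<open>auto simp: monomial_mat_index\<close>)
  finally show ?thesis using assms by simp
qed

lemma monomial_mat_mult:
  assumes "\<And>i. i < m \<Longrightarrow> \<pi> i < m"
  shows "monomial_mat m \<pi> a * monomial_mat m \<rho> b = monomial_mat m (\<rho> \<circ> \<pi>) (\<lambda>i. a i * b (\<pi> i))"
proof (rule eq_matI)
  fix i j assume "i < dim_row (monomial_mat m (\<rho> \<circ> \<pi>) (\<lambda>i. a i * b (\<pi> i)))"
    "j < dim_col (monomial_mat m (\<rho> \<circ> \<pi>) (\<lambda>i. a i * b (\<pi> i)))"
  then have ij: "i < m" "j < m" by auto
  then show "(monomial_mat m \<pi> a * monomial_mat m \<rho> b) $$ (i, j) =
      monomial_mat m (\<rho> \<circ> \<pi>) (\<lambda>i. a i * b (\<pi> i)) $$ (i, j)"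
    using monomial_mat_mult_index[OF monomial_mat_carrier, of \<pi> i m j a \<rho> b] assms[OF ij(1)]
    by (simp add: monomial_mat_index)
qed auto

lemma monomial_mat_form_index:
  assumes \<pi>: "\<And>i. i < 2 * n \<Longrightarrow> \<pi> i < 2 * n" and ij: "i < 2 * n" "j < 2 * n"
  shows "(monomial_mat (2 * n) \<pi> a * symplectic_form n * transpose_mat (monomial_mat (2 * n) \<pi> a)) $$ (i, j)
    = a i * a j * symplectic_form n $$ (\<pi> i, \<pi> j)"
proof -
  let ?A = "monomial_mat (2 * n) \<pi> a" and ?J = "symplectic_form n"
  have AJ: "?A * ?J \<in> carrier_mat (2 * n) (2 * n)" by simp
  have "(?A * ?J * transpose_mat ?A) $$ (i, j) = (\<Sum>l<2 * n. (?A * ?J) $$ (i, l) * ?A $$ (j, l))"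
    using ij by (simp add: scalar_prod_def lessThan_atLeast0)
  also have "\<dots> = (\<Sum>l<2 * n. if l = \<pi> j then (?A * ?J) $$ (i, l) * a j else 0)"
    by (rule sum.cong[OF refl]) (use ij in \<open>auto simp: monomial_mat_index\<close>)
  also have "\<dots> = (?A * ?J) $$ (i, \<pi> j) * a j" using \<pi> ij by simp
  also have "\<dots> = a i * a j * ?J $$ (\<pi> i, \<pi> j)"
    using monomial_mat_mult_index[OF symplectic_form_carrier, of \<pi> i n "\<pi> j" a] \<pi> ij by simp
  finally show ?thesis .
qed

lemma monomial_mat_in_Sp_iff:
  assumes \<pi>: "\<And>i. i < 2 * n \<Longrightarrow> \<pi> i < 2 * n"
  shows "monomial_mat (2 * n) \<pi> (a :: nat \<Rightarrow> 'a::field) \<in> Sp n \<longleftrightarrow>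
    (\<forall>i<2 * n. \<forall>j<2 * n. a i * a j * symplectic_form n $$ (\<pi> i, \<pi> j) = symplectic_form n $$ (i, j))"
    (is "?L \<longleftrightarrow> ?R")
proof
  assume ?L
  then have eq: "monomial_mat (2 * n) \<pi> a * symplectic_form n * transpose_mat (monomial_mat (2 * n) \<pi> a)
      = symplectic_form n"
    by (simp add: Sp_iff_transpose)
  show ?R
    using monomial_mat_form_index[of n \<pi> _ _ a] \<pi> unfolding eq by simp
next
  assume R: ?R
  have "monomial_mat (2 * n) \<pi> a * symplectic_form n * transpose_mat (monomial_mat (2 * n) \<pi> a)
      = symplectic_form n"
  proof (rule eq_matI)
    fix i j assume "i < dim_row (symplectic_form n :: 'a mat)" "j < dim_col (symplectic_form n :: 'a mat)"
    then have ij: "i < 2 * n" "j < 2 * n" by auto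
    then show "(monomial_mat (2 * n) \<pi> a * symplectic_form n * transpose_mat (monomial_mat (2 * n) \<pi> a)) $$ (i, j)
        = symplectic_form n $$ (i, j)"
      using R monomial_mat_form_index[of n \<pi> i j a] \<pi> by simp
  qed auto
  then show ?L by (simp add: Sp_iff_transpose)
qed

lemma symplectic_form_dual_index:
  assumes "i < 2 * n"
  shows "symplectic_form n $$ (i, dual_index n i) \<noteq> (0::'k::field)"
  using assms dual_index_less[OF assms] by (simp add: symplectic_form_index)

lemma Sp_inv_eq:
  fixes A B :: "'k::field mat"
  assumes A: "A \<in> Sp n" and B: "B \<in> carrier_mat (2 * n) (2 * n)" and AB: "A * B = 1\<^sub>m (2 * n)"
  shows "inv\<^bsub>matrix_group (2 * n) (Sp n)\<^esub> A = B"
proof -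
  interpret G: group "matrix_group (2 * n) (Sp n) :: 'k mat monoid" by (rule group_Sp)
  let ?I = "inv\<^bsub>matrix_group (2 * n) (Sp n)\<^esub> A"
  have I: "?I \<in> Sp n" "?I * A = 1\<^sub>m (2 * n)" using G.inv_closed[of A] G.l_inv[of A] A by auto
  have c: "?I \<in> carrier_mat (2 * n) (2 * n)" "A \<in> carrier_mat (2 * n) (2 * n)"
    using I A by (auto dest: Sp_carrier)
  have "?I = ?I * (A * B)" using AB c by simp
  also have "\<dots> = (?I * A) * B" using c B by (simp add: square_mult_assoc[of _ "2 * n"])
  also have "\<dots> = B" using I B by simp
  finally show ?thesis .
qed

text \<open>The function \<open>\<pi>\<close> is injective because it respects the pairing of indices: if \<open>\<pi> i = \<pi> j\<close>, then \<open>i\<close>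
  and \<open>j\<close> have the same partner.\<close>

lemma monomial_mat_inverse:
  fixes a :: "nat \<Rightarrow> 'k::field"
  assumes \<pi>: "\<And>i. i < 2 * n \<Longrightarrow> \<pi> i < 2 * n" and Sp: "monomial_mat (2 * n) \<pi> a \<in> Sp n"
  obtains \<rho> where "\<And>i. i < 2 * n \<Longrightarrow> \<rho> i < 2 * n"
    "inv\<^bsub>matrix_group (2 * n) (Sp n)\<^esub> (monomial_mat (2 * n) \<pi> a)
       = monomial_mat (2 * n) \<rho> (\<lambda>i. inverse (a (\<rho> i)))"
proof -
  let ?J = "symplectic_form n :: 'k mat"
  have J: "a i * a j * ?J $$ (\<pi> i, \<pi> j) = ?J $$ (i, j)" if "i < 2 * n" "j < 2 * n" for i j
    using Sp that monomial_mat_in_Sp_iff[of n \<pi> a] \<pi> by blast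
  have a0: "a i \<noteq> 0" if "i < 2 * n" for i
    using J[OF that dual_index_less[OF that]] symplectic_form_dual_index[OF that] by (metis mult_zero_left)
  have inj: "inj_on \<pi> {..<2 * n}"
  proof (rule inj_onI)
    fix i j assume "i \<in> {..<2 * n}" "j \<in> {..<2 * n}" and eq: "\<pi> i = \<pi> j"
    then have ij: "i < 2 * n" "j < 2 * n" by auto
    let ?l = "dual_index n i"
    have l: "?l < 2 * n" by (rule dual_index_less[OF ij(1)])
    have "?J $$ (\<pi> i, \<pi> ?l) \<noteq> 0"
      using J[OF ij(1) l] symplectic_form_dual_index[OF ij(1)] by (metis mult_zero_right)
    then have "?J $$ (j, ?l) \<noteq> 0" using J[OF ij(2) l] a0[OF ij(2)] a0[OF l] eq by (metis mult_eq_0_iff)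
    then have "?l = dual_index n j" using ij l by (simp add: symplectic_form_index split: if_splits)
    then show "i = j" using dual_index_dual_index ij by metis
  qed
  have img: "\<pi> ` {..<2 * n} = {..<2 * n}"
    by (rule endo_inj_surj[OF _ _ inj]) (use \<pi> in auto)
  define \<rho> where "\<rho> = inv_into {..<2 * n} \<pi>"
  have \<rho>: "\<rho> i < 2 * n" if "i < 2 * n" for i
    using inv_into_into[of i \<pi> "{..<2 * n}"] img that by (simp add: \<rho>_def)
  have \<rho>\<pi>: "\<rho> (\<pi> i) = i" if "i < 2 * n" for i
    using inv_into_f_f[OF inj] that by (simp add: \<rho>_def)
  have "monomial_mat (2 * n) \<pi> a * monomial_mat (2 * n) \<rho> (\<lambda>i. inverse (a (\<rho> i)))
      = monomial_mat (2 * n) (\<rho> \<circ> \<pi>) (\<lambda>i. a i * inverse (a (\<rho> (\<pi> i))))"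
    by (rule monomial_mat_mult) (rule \<pi>)
  also have "\<dots> = 1\<^sub>m (2 * n)"
    unfolding one_eq_monomial_mat by (rule monomial_mat_cong) (use a0 \<rho>\<pi> in auto)
  finally have "inv\<^bsub>matrix_group (2 * n) (Sp n)\<^esub> (monomial_mat (2 * n) \<pi> a)
      = monomial_mat (2 * n) \<rho> (\<lambda>i. inverse (a (\<rho> i)))"
    by (rule Sp_inv_eq[OF Sp monomial_mat_carrier])
  then show ?thesis by (intro that[of \<rho>] \<rho>)
qed

definition standard_torus :: "nat \<Rightarrow> 'k::field mat set" where
  "standard_torus n = {A \<in> Sp n. diagonal_mat A}"

lemma diagonal_in_Sp_iff:
  "monomial_mat (2 * n) id a \<in> Sp n \<longleftrightarrow> (\<forall>i<n. a i * a (i + n) = 1)"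
proof -
  have "(\<forall>i<2 * n. \<forall>j<2 * n. a i * a j * symplectic_form n $$ (i, j) = symplectic_form n $$ (i, j))
      \<longleftrightarrow> (\<forall>i<n. a i * a (i + n) = 1)" (is "?L \<longleftrightarrow> ?R")
  proof
    assume L: ?L
    show ?R
    proof (intro allI impI)
      fix i assume "i < n"
      then show "a i * a (i + n) = 1" using L[rule_format, of i "i + n"]
        by (simp add: symplectic_form_index dual_index_def)
    qed
  next
    assume R: ?R
    show ?L
    proof (intro allI impI)
      fix i j assume ij: "i < 2 * n" "j < 2 * n"
      show "a i * a j * symplectic_form n $$ (i, j) = symplectic_form n $$ (i, j)"
      proof (cases "j = dual_index n i")
        case True
        have "a i * a j = 1"
          using R[rule_format, of i] R[rule_format, of "i - n"] ij
          by (cases "i < n") (auto simp: True dual_index_def mult.commute)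
        then show ?thesis by simp
      qed (use ij in \<open>simp add: symplectic_form_index\<close>)
    qed
  qed
  then show ?thesis by (subst monomial_mat_in_Sp_iff) auto
qed

lemma standard_torus_iff:
  "A \<in> standard_torus n \<longleftrightarrow> (\<exists>a. A = monomial_mat (2 * n) id a \<and> (\<forall>i<n. a i * a (i + n) = 1))"
proof
  assume A: "A \<in> standard_torus n"
  then have "A \<in> Sp n" "diagonal_mat A" by (auto simp: standard_torus_def)
  then have eq: "A = monomial_mat (2 * n) id (\<lambda>i. A $$ (i, i))"
    by (intro diagonal_eq_monomial_mat Sp_carrier)
  have "monomial_mat (2 * n) id (\<lambda>i. A $$ (i, i)) \<in> Sp n"
    using \<open>A \<in> Sp n\<close> by (subst eq[symmetric])
  then show "\<exists>a. A = monomial_mat (2 * n) id a \<and> (\<forall>i<n. a i * a (i + n) = 1)"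
    unfolding diagonal_in_Sp_iff using eq by blast
qed (auto simp: standard_torus_def diagonal_in_Sp_iff diagonal_monomial_mat)

lemma standard_torus_subgroup:
  "subgroup (standard_torus n :: 'k::field mat set) (matrix_group (2 * n) (Sp n))"
proof -
  interpret G: group "matrix_group (2 * n) (Sp n) :: 'k mat monoid" by (rule group_Sp)
  show ?thesis
  proof (rule G.subgroupI)
    show "standard_torus n \<subseteq> carrier (matrix_group (2 * n) (Sp n))" by (auto simp: standard_torus_def)
    have "(1\<^sub>m (2 * n) :: 'k mat) \<in> standard_torus n" by (auto simp: standard_torus_iff one_eq_monomial_mat)
    then show "standard_torus n \<noteq> ({} :: 'k mat set)" by blast
  next
    fix A :: "'k mat" assume A: "A \<in> standard_torus n"
    then obtain a where a: "A = monomial_mat (2 * n) id a" "\<forall>i<n. a i * a (i + n) = 1"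
      by (auto simp: standard_torus_iff)
    have nz: "a i \<noteq> 0" if "i < 2 * n" for i
    proof (cases "i < n")
      case False
      then have "i - n < n" "i - n + n = i" using that by auto
      then show ?thesis using a(2) by (metis mult_zero_right zero_neq_one)
    qed (use a(2) in force)
    have ASp: "A \<in> Sp n" using A by (simp add: standard_torus_def)
    have "A * monomial_mat (2 * n) id (\<lambda>i. inverse (a i)) = 1\<^sub>m (2 * n)"
      unfolding a(1) one_eq_monomial_mat
      by (subst monomial_mat_mult) (use nz in \<open>auto intro!: monomial_mat_cong\<close>)
    then have "inv\<^bsub>matrix_group (2 * n) (Sp n)\<^esub> A = monomial_mat (2 * n) id (\<lambda>i. inverse (a i))"
      by (rule Sp_inv_eq[OF ASp monomial_mat_carrier])
    then have "diagonal_mat (inv\<^bsub>matrix_group (2 * n) (Sp n)\<^esub> A)" by (simp add: diagonal_monomial_mat)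
    moreover have "inv\<^bsub>matrix_group (2 * n) (Sp n)\<^esub> A \<in> Sp n"
      using G.inv_closed[of A] A by (simp add: standard_torus_def)
    ultimately show "inv\<^bsub>matrix_group (2 * n) (Sp n)\<^esub> A \<in> standard_torus n"
      by (simp add: standard_torus_def)
  next
    fix A B :: "'k mat" assume AB: "A \<in> standard_torus n" "B \<in> standard_torus n"
    then obtain a b where ab: "A = monomial_mat (2 * n) id a" "B = monomial_mat (2 * n) id b"
      by (auto simp: standard_torus_iff)
    have "A * B = monomial_mat (2 * n) id (\<lambda>i. a i * b i)"
      unfolding ab by (subst monomial_mat_mult) auto
    then have "diagonal_mat (A * B)" by (simp add: diagonal_monomial_mat)
    moreover have "A * B \<in> Sp n" using G.m_closed[of A B] AB by (simp add: standard_torus_def)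
    ultimately show "A \<otimes>\<^bsub>matrix_group (2 * n) (Sp n)\<^esub> B \<in> standard_torus n"
      by (simp add: standard_torus_def)
  qed
qed

lemma (in group) normalizer_iff:
  assumes "T \<subseteq> carrier G"
  shows "g \<in> normalizer G T \<longleftrightarrow> g \<in> carrier G \<and> (\<lambda>t. g \<otimes> t \<otimes> inv g) ` T = T"
proof -
  have "g <# T #> inv g = (\<lambda>t. g \<otimes> t \<otimes> inv g) ` T" unfolding l_coset_def r_coset_def by blast
  then show ?thesis using assms by (auto simp: normalizer_def stabilizer_def)
qed

lemma (in group) normalizer_move:
  assumes T: "T \<subseteq> carrier G" and g: "g \<in> normalizer G T" and t: "t \<in> T"
  shows "\<exists>s\<in>T. s \<otimes> g = g \<otimes> t"
proof
  have gG: "g \<in> carrier G" and eq: "(\<lambda>t. g \<otimes> t \<otimes> inv g) ` T = T"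
    using g normalizer_iff[OF T] by auto
  have "t \<in> carrier G" using T t by blast
  then show "g \<otimes> t \<otimes> inv g \<otimes> g = g \<otimes> t" using gG by (simp add: m_assoc)
  show "g \<otimes> t \<otimes> inv g \<in> T" using eq t by blast
qed

lemma (in group) normalizerI:
  assumes T: "T \<subseteq> carrier G" and g: "g \<in> carrier G"
    and 1: "\<And>t. t \<in> T \<Longrightarrow> g \<otimes> t \<otimes> inv g \<in> T" and 2: "\<And>t. t \<in> T \<Longrightarrow> inv g \<otimes> t \<otimes> g \<in> T"
  shows "g \<in> normalizer G T"
proof -
  have "t \<in> (\<lambda>t. g \<otimes> t \<otimes> inv g) ` T" if t: "t \<in> T" for t
  proof (rule image_eqI[OF _ 2[OF t]])
    have "t \<in> carrier G" using T t by blast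
    then show "t = g \<otimes> (inv g \<otimes> t \<otimes> g) \<otimes> inv g" using g
      by (simp add: m_assoc) (simp add: m_assoc[symmetric])
  qed
  then show ?thesis using normalizer_iff[OF T] g 1 by blast
qed

text \<open>Moving \<open>monomial_mat (2 * n) \<pi> a\<close> past a diagonal matrix permutes the diagonal entries of the
  latter by \<open>\<pi>\<close>. The inverse is monomial too, which gives the other inclusion.\<close>

lemma monomial_normalizes:
  fixes a :: "nat \<Rightarrow> 'k::field"
  assumes \<pi>: "\<And>i. i < 2 * n \<Longrightarrow> \<pi> i < 2 * n" and Sp: "monomial_mat (2 * n) \<pi> a \<in> Sp n"
  shows "monomial_mat (2 * n) \<pi> a \<in> normalizer (matrix_group (2 * n) (Sp n)) (standard_torus n)"
proof -
  let ?G = "matrix_group (2 * n) (Sp n) :: 'k mat monoid"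
  interpret G: group ?G by (rule group_Sp)
  have conj: "g * t * inv\<^bsub>?G\<^esub> g \<in> standard_torus n"
    if g: "g \<in> Sp n" "g = monomial_mat (2 * n) \<rho> b" and t: "t \<in> standard_torus n"
      and \<rho>: "\<And>i. i < 2 * n \<Longrightarrow> \<rho> i < 2 * n" for g t \<rho> b
  proof -
    obtain c where c: "t = monomial_mat (2 * n) id c" using t by (auto simp: standard_torus_iff)
    define s where "s = monomial_mat (2 * n) id (\<lambda>i. c (\<rho> i))"
    have gt: "g * t = s * g"
    proof -
      have "g * t = monomial_mat (2 * n) (id \<circ> \<rho>) (\<lambda>i. b i * c (\<rho> i))"
        unfolding g(2) c by (rule monomial_mat_mult) (rule \<rho>)
      moreover have "s * g = monomial_mat (2 * n) (\<rho> \<circ> id) (\<lambda>i. c (\<rho> i) * b (id i))"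
        unfolding g(2) s_def by (rule monomial_mat_mult) simp
      ultimately show ?thesis by (simp add: mult.commute)
    qed
    have I: "inv\<^bsub>?G\<^esub> g \<in> Sp n" "g * inv\<^bsub>?G\<^esub> g = 1\<^sub>m (2 * n)"
      using G.inv_closed[of g] G.r_inv[of g] g by auto
    have tSp: "t \<in> Sp n" using t by (simp add: standard_torus_def)
    have "g * t * inv\<^bsub>?G\<^esub> g = s * (g * inv\<^bsub>?G\<^esub> g)"
      unfolding gt using Sp_carrier[OF g(1)] Sp_carrier[OF I(1)]
      by (simp add: s_def square_mult_assoc[of _ "2 * n"])
    then have eq: "g * t * inv\<^bsub>?G\<^esub> g = s" by (simp add: I s_def right_mult_one_mat[of _ "2 * n"])
    have "g * t * inv\<^bsub>?G\<^esub> g \<in> Sp n"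
      using G.m_closed[of "g * t" "inv\<^bsub>?G\<^esub> g"] G.m_closed[of g t] g(1) tSp I(1) by simp
    then show ?thesis unfolding eq by (simp add: standard_torus_def s_def diagonal_monomial_mat)
  qed
  let ?A = "monomial_mat (2 * n) \<pi> a"
  obtain \<rho> where \<rho>: "\<And>i. i < 2 * n \<Longrightarrow> \<rho> i < 2 * n"
    "inv\<^bsub>?G\<^esub> ?A = monomial_mat (2 * n) \<rho> (\<lambda>i. inverse (a (\<rho> i)))"
    using monomial_mat_inverse[of n \<pi> a] \<pi> Sp by blast
  have I: "inv\<^bsub>?G\<^esub> ?A \<in> Sp n" "inv\<^bsub>?G\<^esub> (inv\<^bsub>?G\<^esub> ?A) = ?A"
    using G.inv_closed[of ?A] G.inv_inv[of ?A] Sp by auto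
  show ?thesis
  proof (rule G.normalizerI)
    show "standard_torus n \<subseteq> carrier ?G" by (auto simp: standard_torus_def)
    show "?A \<in> carrier ?G" using Sp by simp
    fix t :: "'k mat" assume t: "t \<in> standard_torus n"
    show "?A \<otimes>\<^bsub>?G\<^esub> t \<otimes>\<^bsub>?G\<^esub> inv\<^bsub>?G\<^esub> ?A \<in> standard_torus n"
      using conj[OF Sp refl t] \<pi> by simp
    show "inv\<^bsub>?G\<^esub> ?A \<otimes>\<^bsub>?G\<^esub> t \<otimes>\<^bsub>?G\<^esub> ?A \<in> standard_torus n"
      using conj[OF I(1) \<rho>(2) t] \<rho>(1) I(2) by simp
  qed
qed

lemma standard_torus_separates:
  assumes jk: "j < 2 * n" "k < 2 * n" "j \<noteq> k"
  obtains b :: "nat \<Rightarrow> 'k::alg_closed_field"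
    where "monomial_mat (2 * n) id b \<in> standard_torus n" "b j \<noteq> b k"
proof -
  obtain c :: 'k where c: "c \<noteq> 0" "c \<noteq> 1" "c * c \<noteq> 1" by (rule ex_generic_unit)
  have ci: "inverse c \<noteq> c" "inverse c \<noteq> 1" using c by (auto simp: field_simps)
  define q where "q = (if j < n then j else j - n)"
  have q: "q < n" using jk by (auto simp: q_def)
  define b where "b i = (if i = q then c else if i = q + n then inverse c else 1)" for i
  have "monomial_mat (2 * n) id b \<in> standard_torus n"
    using q c by (auto simp: standard_torus_iff b_def intro!: exI[of _ b])
  moreover have "b j \<noteq> b k" using jk c ci by (auto simp: b_def q_def split: if_splits)
  ultimately show ?thesis using that by blast
qed

text \<open>If \<open>A t = s A\<close> with \<open>s\<close> and \<open>t\<close> diagonal and row \<open>i\<close> of \<open>A\<close> has nonzero entries in the columns \<open>j\<close>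
  and \<open>k\<close>, then the entries \<open>j\<close> and \<open>k\<close> of \<open>t\<close> both agree with entry \<open>i\<close> of \<open>s\<close>. As the torus
  separates indices, each row of \<open>A\<close> has only one nonzero entry.\<close>

lemma normalizer_monomial:
  fixes A :: "'k::alg_closed_field mat"
  assumes A: "A \<in> normalizer (matrix_group (2 * n) (Sp n)) (standard_torus n)"
  obtains \<pi> a where "\<And>i. i < 2 * n \<Longrightarrow> \<pi> i < 2 * n" "A = monomial_mat (2 * n) \<pi> a"
proof -
  let ?G = "matrix_group (2 * n) (Sp n) :: 'k mat monoid"
  interpret G: group ?G by (rule group_Sp)
  have sub: "standard_torus n \<subseteq> carrier ?G" by (auto simp: standard_torus_def)
  have ASp: "A \<in> Sp n" using A G.normalizer_iff[OF sub] by auto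
  have Ac: "A \<in> carrier_mat (2 * n) (2 * n)" using ASp by (rule Sp_carrier)
  have unique: "j = k" if i: "i < 2 * n" and jk: "j < 2 * n" "k < 2 * n"
    and nz: "A $$ (i, j) \<noteq> 0" "A $$ (i, k) \<noteq> 0" for i j k
  proof (rule ccontr)
    assume "j \<noteq> k"
    then obtain b :: "nat \<Rightarrow> 'k" where b: "monomial_mat (2 * n) id b \<in> standard_torus n" "b j \<noteq> b k"
      using standard_torus_separates[OF jk] by metis
    let ?t = "monomial_mat (2 * n) id b"
    obtain s where s: "s \<in> standard_torus n" "s \<otimes>\<^bsub>?G\<^esub> A = A \<otimes>\<^bsub>?G\<^esub> ?t"
      using G.normalizer_move[OF sub A b(1)] by blast
    then obtain c where "s = monomial_mat (2 * n) id c" by (auto simp: standard_torus_iff)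
    then have eq: "monomial_mat (2 * n) id c * A = A * ?t" using s(2) by simp
    have "c i * A $$ (i, l) = A $$ (i, l) * b l" if l: "l < 2 * n" for l
      using arg_cong[OF eq, of "\<lambda>M. M $$ (i, l)"] mult_diagonal_index[OF Ac i l, of b]
        monomial_mat_mult_index[OF Ac, of id i l c] i l by simp
    from this[OF jk(1)] this[OF jk(2)] show False using nz b(2) by simp
  qed
  have ex: "\<exists>j<2 * n. A $$ (i, j) \<noteq> 0" if i: "i < 2 * n" for i
  proof (rule ccontr)
    assume "\<not> ?thesis"
    then have z: "A $$ (i, l) = 0" if "l < 2 * n" for l using that by blast
    let ?I = "inv\<^bsub>?G\<^esub> A"
    have I: "?I \<in> Sp n" "A * ?I = 1\<^sub>m (2 * n)" using G.inv_closed[of A] G.r_inv[of A] ASp by auto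
    have "(A * ?I) $$ (i, i) = (\<Sum>l<2 * n. A $$ (i, l) * ?I $$ (l, i))"
      using i Ac Sp_carrier[OF I(1)] by (simp add: scalar_prod_def lessThan_atLeast0)
    also have "\<dots> = 0" by (rule sum.neutral) (simp add: z)
    finally show False using I(2) i by simp
  qed
  define \<pi> where "\<pi> i = (SOME j. j < 2 * n \<and> A $$ (i, j) \<noteq> 0)" for i
  have \<pi>: "\<pi> i < 2 * n" "A $$ (i, \<pi> i) \<noteq> 0" if "i < 2 * n" for i
    using someI_ex[OF ex[OF that, folded Bex_def]] ex[OF that]
    unfolding \<pi>_def by (metis (mono_tags, lifting) someI_ex)+
  have "A = monomial_mat (2 * n) \<pi> (\<lambda>i. A $$ (i, \<pi> i))"
  proof (rule eq_matI)
    fix i j assume "i < dim_row (monomial_mat (2 * n) \<pi> (\<lambda>i. A $$ (i, \<pi> i)))"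
      "j < dim_col (monomial_mat (2 * n) \<pi> (\<lambda>i. A $$ (i, \<pi> i)))"
    then have ij: "i < 2 * n" "j < 2 * n" by auto
    then show "A $$ (i, j) = monomial_mat (2 * n) \<pi> (\<lambda>i. A $$ (i, \<pi> i)) $$ (i, j)"
      using unique[OF ij(1) ij(2) \<pi>(1)[OF ij(1)] _ \<pi>(2)[OF ij(1)]] by (auto simp: monomial_mat_index)
  qed (use Ac in auto)
  then show ?thesis using that \<pi>(1) by blast
qed

section \<open>Complements of the diagonal torus\<close>

definition permutation_mats :: "nat \<Rightarrow> 'k::field mat set" where
  "permutation_mats n = {A \<in> Sp n. \<exists>\<pi>. (\<forall>i<2 * n. \<pi> i < 2 * n) \<and> A = monomial_mat (2 * n) \<pi> (\<lambda>_. 1)}"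

lemma permutation_mats_subgroup:
  "subgroup (permutation_mats n :: 'k::field mat set) (matrix_group (2 * n) (Sp n))"
proof -
  let ?G = "matrix_group (2 * n) (Sp n) :: 'k mat monoid"
  interpret G: group ?G by (rule group_Sp)
  show ?thesis
  proof (rule G.subgroupI)
    show "permutation_mats n \<subseteq> carrier ?G" by (auto simp: permutation_mats_def)
    have "(1\<^sub>m (2 * n) :: 'k mat) \<in> Sp n" using G.one_closed by simp
    then have "(1\<^sub>m (2 * n) :: 'k mat) \<in> permutation_mats n"
      unfolding permutation_mats_def by (auto intro!: exI[of _ id] one_eq_monomial_mat)
    then show "permutation_mats n \<noteq> ({} :: 'k mat set)" by blast
  next
    fix A :: "'k mat" assume A: "A \<in> permutation_mats n"
    then obtain \<pi> where \<pi>: "\<And>i. i < 2 * n \<Longrightarrow> \<pi> i < 2 * n" "A = monomial_mat (2 * n) \<pi> (\<lambda>_. 1)"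
      by (auto simp: permutation_mats_def)
    have ASp: "A \<in> Sp n" using A by (simp add: permutation_mats_def)
    obtain \<rho> where "\<And>i. i < 2 * n \<Longrightarrow> \<rho> i < 2 * n" "inv\<^bsub>?G\<^esub> A = monomial_mat (2 * n) \<rho> (\<lambda>_. 1)"
      using monomial_mat_inverse[of n \<pi> "\<lambda>_. 1 :: 'k"] \<pi> ASp by auto
    moreover have "inv\<^bsub>?G\<^esub> A \<in> Sp n" using G.inv_closed[of A] ASp by simp
    ultimately show "inv\<^bsub>?G\<^esub> A \<in> permutation_mats n" by (auto simp: permutation_mats_def)
  next
    fix A B :: "'k mat" assume AB: "A \<in> permutation_mats n" "B \<in> permutation_mats n"
    obtain \<pi> where \<pi>: "\<And>i. i < 2 * n \<Longrightarrow> \<pi> i < 2 * n" "A = monomial_mat (2 * n) \<pi> (\<lambda>_. 1)"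
      using AB(1) by (auto simp: permutation_mats_def)
    obtain \<rho> where \<rho>: "\<And>i. i < 2 * n \<Longrightarrow> \<rho> i < 2 * n" "B = monomial_mat (2 * n) \<rho> (\<lambda>_. 1)"
      using AB(2) by (auto simp: permutation_mats_def)
    have "A * B = monomial_mat (2 * n) (\<rho> \<circ> \<pi>) (\<lambda>i. 1 * 1)"
      unfolding \<pi>(2) \<rho>(2) by (rule monomial_mat_mult) (rule \<pi>(1))
    then have "\<exists>\<tau>. (\<forall>i<2 * n. \<tau> i < 2 * n) \<and> A * B = monomial_mat (2 * n) \<tau> (\<lambda>_. 1)"
      using \<pi>(1) \<rho>(1) by (intro exI[of _ "\<rho> \<circ> \<pi>"]) auto
    moreover have "A * B \<in> Sp n" using G.m_closed[of A B] AB by (simp add: permutation_mats_def)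
    ultimately show "A \<otimes>\<^bsub>?G\<^esub> B \<in> permutation_mats n" by (simp add: permutation_mats_def)
  qed
qed

lemma standard_torus_complement_char_2:
  assumes two: "(1 :: 'k::alg_closed_field) = - 1"
  shows "has_complement (matrix_group (2 * n) (Sp n)) (standard_torus n :: 'k mat set)
    (normalizer (matrix_group (2 * n) (Sp n)) (standard_torus n))"
proof -
  let ?G = "matrix_group (2 * n) (Sp n) :: 'k mat monoid"
  let ?T = "standard_torus n :: 'k mat set"
  let ?H = "permutation_mats n :: 'k mat set"
  let ?N = "normalizer ?G ?T"
  interpret G: group ?G by (rule group_Sp)
  have sub: "?T \<subseteq> carrier ?G" by (auto simp: standard_torus_def)
  have N: "subgroup ?N ?G" by (rule G.normalizer_imp_subgroup[OF sub])
  have HN: "?H \<subseteq> ?N" using monomial_normalizes by (auto simp: permutation_mats_def)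
  have TN: "?T \<subseteq> ?N"
  proof
    fix t assume t: "t \<in> ?T"
    then obtain a where "t = monomial_mat (2 * n) id a" by (auto simp: standard_torus_iff)
    then show "t \<in> ?N" using monomial_normalizes[of n id a] t by (simp add: standard_torus_def)
  qed
  have NTH: "?N \<subseteq> ?T <#>\<^bsub>?G\<^esub> ?H"
  proof
    fix A assume A: "A \<in> ?N"
    then have ASp: "A \<in> Sp n" using G.normalizer_iff[OF sub] by simp
    obtain \<pi> a where \<pi>: "\<And>i. i < 2 * n \<Longrightarrow> \<pi> i < 2 * n" and Aeq: "A = monomial_mat (2 * n) \<pi> a"
      using normalizer_monomial[OF A] by blast
    have J: "a i * a j * symplectic_form n $$ (\<pi> i, \<pi> j) = symplectic_form n $$ (i, j)"
      if "i < 2 * n" "j < 2 * n" for i j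
      using ASp that unfolding Aeq by (subst (asm) monomial_mat_in_Sp_iff) (use \<pi> in auto)
    have J01: "(symplectic_form n :: 'k mat) $$ (i, j) \<in> {0, 1}" if "i < 2 * n" "j < 2 * n" for i j
      using that by (simp add: symplectic_form_index two[symmetric])
    \<comment> \<open>The relations \<open>J\<close> say that \<open>\<pi>\<close> preserves the form up to nonzero scalars; for entries in
      \<open>{0, 1}\<close> that means equality.\<close>
    have perm: "(symplectic_form n :: 'k mat) $$ (\<pi> i, \<pi> j) = symplectic_form n $$ (i, j)"
      if ij: "i < 2 * n" "j < 2 * n" for i j
    proof -
      have "a i \<noteq> 0" if "i < 2 * n" for i
        using J[OF that dual_index_less[OF that]] symplectic_form_dual_index[OF that] by (metis mult_zero_left)
      then have "a i * a j \<noteq> 0" using ij by simp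
      then have "symplectic_form n $$ (\<pi> i, \<pi> j) = (0::'k) \<longleftrightarrow> symplectic_form n $$ (i, j) = (0::'k)"
        using J[OF ij] by (metis mult_eq_0_iff)
      then show ?thesis using J01[OF ij] J01[OF \<pi>[OF ij(1)] \<pi>[OF ij(2)]] by auto
    qed
    have P: "monomial_mat (2 * n) \<pi> (\<lambda>_. 1) \<in> ?H"
      unfolding permutation_mats_def using perm \<pi> by (auto simp: monomial_mat_in_Sp_iff)
    have "monomial_mat (2 * n) id a \<in> Sp n"
      using J perm by (simp add: monomial_mat_in_Sp_iff)
    then have d: "monomial_mat (2 * n) id a \<in> ?T" by (simp add: standard_torus_def diagonal_monomial_mat)
    have "monomial_mat (2 * n) id a * monomial_mat (2 * n) \<pi> (\<lambda>_. 1) = monomial_mat (2 * n) (\<pi> \<circ> id) (\<lambda>i. a i * 1)"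
      by (rule monomial_mat_mult) simp
    then have "A = monomial_mat (2 * n) id a * monomial_mat (2 * n) \<pi> (\<lambda>_. 1)" by (simp add: Aeq)
    then show "A \<in> ?T <#>\<^bsub>?G\<^esub> ?H" using d P unfolding set_mult_def by auto
  qed
  have "?T <#>\<^bsub>?G\<^esub> ?H \<subseteq> ?N"
    using subgroup.m_closed[OF N] TN HN unfolding set_mult_def by blast
  moreover have "?T \<inter> ?H = {\<one>\<^bsub>?G\<^esub>}"
  proof
    show "?T \<inter> ?H \<subseteq> {\<one>\<^bsub>?G\<^esub>}"
    proof
      fix A assume A: "A \<in> ?T \<inter> ?H"
      then obtain \<pi> where \<pi>: "A = monomial_mat (2 * n) \<pi> (\<lambda>_. 1)" by (auto simp: permutation_mats_def)
      obtain a where a: "A = monomial_mat (2 * n) id a" "\<forall>i<n. a i * a (i + n) = 1"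
        using A by (auto simp: standard_torus_iff)
      have "a i = 1" if i: "i < 2 * n" for i
      proof -
        have "a i \<noteq> 0"
        proof (cases "i < n")
          case False
          then have "i - n < n" "i - n + n = i" using i by auto
          then show ?thesis using a(2) by (metis mult_zero_right zero_neq_one)
        qed (use a(2) in force)
        moreover have "a i = (if i = \<pi> i then 1 else 0)"
          using arg_cong[OF trans[OF a(1)[symmetric] \<pi>], of "\<lambda>M. M $$ (i, i)"] i
          by (simp add: monomial_mat_index)
        ultimately show ?thesis by (simp split: if_splits)
      qed
      then have "A = 1\<^sub>m (2 * n)" unfolding a(1) one_eq_monomial_mat by (intro monomial_mat_cong) auto
      then show "A \<in> {\<one>\<^bsub>?G\<^esub>}" by simp
    qed
    show "{\<one>\<^bsub>?G\<^esub>} \<subseteq> ?T \<inter> ?H"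
      using subgroup.one_closed[OF standard_torus_subgroup] subgroup.one_closed[OF permutation_mats_subgroup]
      by auto
  qed
  ultimately show ?thesis
    unfolding has_complement_def using permutation_mats_subgroup HN NTH by blast
qed

text \<open>The element \<open>w\<close> exchanges the basis vectors 0 and \<open>n\<close>, up to a sign, and lifts a reflection of
  the Weyl group. No lift of this reflection is an involution unless \<open>-1 = 1\<close>.\<close>

lemma standard_torus_complement_imp_char_2:
  fixes n :: nat
  assumes n: "n \<ge> 1"
    and comp: "has_complement (matrix_group (2 * n) (Sp n)) (standard_torus n :: 'k::field mat set)
      (normalizer (matrix_group (2 * n) (Sp n)) (standard_torus n))"
  shows "(1 :: 'k) = - 1"
proof -
  let ?G = "matrix_group (2 * n) (Sp n) :: 'k mat monoid"
  let ?T = "standard_torus n :: 'k mat set"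
  interpret G: group ?G by (rule group_Sp)
  obtain H where H: "subgroup H ?G" "normalizer ?G ?T = ?T <#>\<^bsub>?G\<^esub> H" "?T \<inter> H = {\<one>\<^bsub>?G\<^esub>}"
    using comp unfolding has_complement_def by blast
  define \<pi> where "\<pi> i = (if i = 0 then n else if i = n then 0 else i)" for i
  define e where "e i = (if i = n then - 1 else 1 :: 'k)" for i
  have \<pi>: "\<pi> i < 2 * n" if "i < 2 * n" for i using that n by (auto simp: \<pi>_def)
  define w where "w = monomial_mat (2 * n) \<pi> e"
  have "w \<in> Sp n" unfolding w_def
  proof (subst monomial_mat_in_Sp_iff)
    show "\<forall>i<2 * n. \<forall>j<2 * n. e i * e j * symplectic_form n $$ (\<pi> i, \<pi> j) = symplectic_form n $$ (i, j)"
    proof (intro allI impI)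
      fix i j assume ij: "i < 2 * n" "j < 2 * n"
      then show "e i * e j * symplectic_form n $$ (\<pi> i, \<pi> j) = symplectic_form n $$ (i, j)"
        using \<pi>[OF ij(1)] \<pi>[OF ij(2)] n
        by (auto simp: symplectic_form_index e_def \<pi>_def dual_index_def)
    qed
  qed (rule \<pi>)
  then have "w \<in> normalizer ?G ?T" unfolding w_def by (intro monomial_normalizes \<pi>)
  then obtain d h where dh: "d \<in> ?T" "h \<in> H" "w = d * h" unfolding H(2) set_mult_def by auto
  have d': "inv\<^bsub>?G\<^esub> d \<in> ?T" using subgroup.m_inv_closed[OF standard_torus_subgroup dh(1)] by simp
  have dSp: "d \<in> Sp n" using dh(1) by (simp add: standard_torus_def)
  have hSp: "h \<in> Sp n" using subgroup.mem_carrier[OF H(1) dh(2)] by simp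
  have "h = inv\<^bsub>?G\<^esub> d * w"
  proof -
    have "inv\<^bsub>?G\<^esub> d \<otimes>\<^bsub>?G\<^esub> (d \<otimes>\<^bsub>?G\<^esub> h) = h"
      using G.inv_solve_left[of h d "d \<otimes>\<^bsub>?G\<^esub> h"] G.m_closed[of d h] dSp hSp by simp
    then show ?thesis by (simp add: dh(3))
  qed
  moreover obtain b where b: "inv\<^bsub>?G\<^esub> d = monomial_mat (2 * n) id b" "\<forall>i<n. b i * b (i + n) = 1"
    using d' unfolding standard_torus_iff by blast
  moreover have "monomial_mat (2 * n) id b * w = monomial_mat (2 * n) (\<pi> \<circ> id) (\<lambda>i. b i * e (id i))"
    unfolding w_def by (rule monomial_mat_mult) simp
  ultimately have h: "h = monomial_mat (2 * n) \<pi> (\<lambda>i. b i * e i)" by simp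
  \<comment> \<open>In \<open>h * h\<close> the torus part cancels at the swapped pair of indices, whatever \<open>d\<close> is.\<close>
  have hh: "h * h = monomial_mat (2 * n) (\<pi> \<circ> \<pi>) (\<lambda>i. b i * e i * (b (\<pi> i) * e (\<pi> i)))"
    unfolding h by (rule monomial_mat_mult) (rule \<pi>)
  also have "\<dots> = monomial_mat (2 * n) id (\<lambda>i. b i * e i * (b (\<pi> i) * e (\<pi> i)))"
    by (rule monomial_mat_cong) (auto simp: \<pi>_def)
  finally have hh': "h * h = monomial_mat (2 * n) id (\<lambda>i. b i * e i * (b (\<pi> i) * e (\<pi> i)))" .
  have hhH: "h * h \<in> H" using subgroup.m_closed[OF H(1) dh(2) dh(2)] by simp
  then have "h * h \<in> Sp n" using subgroup.mem_carrier[OF H(1)] by fastforce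
  then have "h * h \<in> ?T" by (simp add: standard_torus_def hh' diagonal_monomial_mat)
  then have "h * h = 1\<^sub>m (2 * n)" using hhH H(3) by auto
  then have "(h * h) $$ (0, 0) = 1" using n by simp
  moreover have "(h * h) $$ (0, 0) = - (b 0 * b n)"
    unfolding hh' using n by (simp add: monomial_mat_index \<pi>_def e_def)
  moreover have "b 0 * b n = 1" using b(2)[rule_format, of 0] n by simp
  ultimately show ?thesis by simp
qed

lemma (in group) conj_hom:
  assumes g: "g \<in> carrier G"
  shows "(\<lambda>x. g \<otimes> x \<otimes> inv g) \<in> hom G G"
proof (rule homI)
  fix x y assume xy: "x \<in> carrier G" "y \<in> carrier G"
  have "g \<otimes> x \<otimes> inv g \<otimes> (g \<otimes> y \<otimes> inv g) = g \<otimes> x \<otimes> (inv g \<otimes> g) \<otimes> y \<otimes> inv g"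
    using g xy by (simp only: m_assoc m_closed inv_closed)
  then show "g \<otimes> (x \<otimes> y) \<otimes> inv g = g \<otimes> x \<otimes> inv g \<otimes> (g \<otimes> y \<otimes> inv g)"
    using g xy by (simp add: m_assoc)
qed (use g in simp)

lemma (in group) normalizer_hom_image:
  assumes f: "f \<in> hom G G" and T: "T \<subseteq> carrier G"
  shows "f ` normalizer G T \<subseteq> normalizer G (f ` T)"
proof
  fix y assume "y \<in> f ` normalizer G T"
  then obtain x where x: "x \<in> normalizer G T" "y = f x" by blast
  then have xG: "x \<in> carrier G" and eq: "(\<lambda>t. x \<otimes> t \<otimes> inv x) ` T = T"
    using normalizer_iff[OF T] by auto
  interpret f: group_hom G G f
    by (rule group_hom.intro) (use f in \<open>auto simp: group_hom_axioms_def is_group\<close>)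
  have fT: "f ` T \<subseteq> carrier G" using T f.hom_closed by blast
  have "f x \<otimes> f t \<otimes> inv (f x) = f (x \<otimes> t \<otimes> inv x)" if "t \<in> T" for t
    using that T xG by (simp add: subset_iff)
  then have "(\<lambda>s. f x \<otimes> s \<otimes> inv (f x)) ` f ` T = f ` (\<lambda>t. x \<otimes> t \<otimes> inv x) ` T"
    by (auto simp: image_image)
  then have "(\<lambda>s. f x \<otimes> s \<otimes> inv (f x)) ` f ` T = f ` T" unfolding eq .
  then show "y \<in> normalizer G (f ` T)" using normalizer_iff[OF fT] f.hom_closed[OF xG] x(2) by blast
qed

lemma (in group) has_complement_conj:
  assumes g: "g \<in> carrier G" and T: "T \<subseteq> carrier G"
    and comp: "has_complement G T (normalizer G T)"
  shows "has_complement G ((\<lambda>t. g \<otimes> t \<otimes> inv g) ` T) (normalizer G ((\<lambda>t. g \<otimes> t \<otimes> inv g) ` T))"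
proof -
  define f where "f x = g \<otimes> x \<otimes> inv g" for x
  define f' where "f' x = inv g \<otimes> x \<otimes> inv (inv g)" for x
  have f: "f \<in> hom G G" unfolding f_def by (rule conj_hom[OF g])
  have f': "f' \<in> hom G G" unfolding f'_def by (rule conj_hom) (use g in simp)
  interpret f: group_hom G G f
    by (rule group_hom.intro) (use f in \<open>auto simp: group_hom_axioms_def is_group\<close>)
  have f'f: "f' (f x) = x" and ff': "f (f' x) = x" if "x \<in> carrier G" for x
  proof -
    show "f' (f x) = x" using g that unfolding f_def f'_def
      by (simp add: m_assoc) (simp add: m_assoc[symmetric])
    show "f (f' x) = x" using g that unfolding f_def f'_def
      by (simp add: m_assoc) (simp add: m_assoc[symmetric])
  qed
  have fT: "f ` T \<subseteq> carrier G" using T f.hom_closed by blast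
  have f'fT: "f' ` f ` T = T" using f'f T by (force simp: image_image)
  have N: "f ` normalizer G T = normalizer G (f ` T)"
  proof
    show "f ` normalizer G T \<subseteq> normalizer G (f ` T)" by (rule normalizer_hom_image[OF f T])
    show "normalizer G (f ` T) \<subseteq> f ` normalizer G T"
    proof
      fix x assume x: "x \<in> normalizer G (f ` T)"
      then have "f' x \<in> normalizer G T" using normalizer_hom_image[OF f' fT] f'fT by auto
      moreover have "x \<in> carrier G" using x normalizer_iff[OF fT] by blast
      ultimately show "x \<in> f ` normalizer G T" using ff' by force
    qed
  qed
  obtain H where H: "subgroup H G" "H \<subseteq> normalizer G T" "normalizer G T = T <#> H" "T \<inter> H = {\<one>}"
    using comp unfolding has_complement_def by blast
  have HG: "H \<subseteq> carrier G" by (rule subgroup.subset[OF H(1)])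
  have "subgroup (f ` H) G" by (rule f.subgroup_img_is_subgroup[OF H(1)])
  moreover have "f ` H \<subseteq> normalizer G (f ` T)" using H(2) N by blast
  moreover have "normalizer G (f ` T) = f ` T <#> f ` H"
  proof -
    have "f ` (T <#> H) = f ` T <#> f ` H"
    proof -
      have "f (t \<otimes> h) = f t \<otimes> f h" if "t \<in> T" "h \<in> H" for t h using that T HG by (simp add: subset_iff)
      then show ?thesis unfolding set_mult_def by force
    qed
    then show ?thesis using N H(3) by simp
  qed
  moreover have "f ` T \<inter> f ` H = {\<one>}"
  proof -
    have "inj_on f (carrier G)" by (rule inj_on_inverseI[of _ f']) (rule f'f)
    then have "f ` T \<inter> f ` H = f ` (T \<inter> H)" using T HG by (metis inj_on_image_Int)
    then show ?thesis using H(4) by simp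
  qed
  ultimately show ?thesis unfolding has_complement_def f_def by blast
qed

section \<open>Conjugates of the diagonal torus are tori\<close>

lemma GL_regular_sum:
  assumes "finite S" "\<And>s. s \<in> S \<Longrightarrow> f s \<in> GL_regular m"
  shows "(\<lambda>A. \<Sum>s\<in>S. f s A) \<in> GL_regular m"
  using assms by (induction S rule: finite_induct) (auto intro: GL_regular.const GL_regular.add)

lemma GL_regular_prod:
  assumes "finite S" "\<And>s. s \<in> S \<Longrightarrow> f s \<in> GL_regular m"
  shows "(\<lambda>A. \<Prod>s\<in>S. f s A) \<in> GL_regular m"
  using assms by (induction S rule: finite_induct) (auto intro: GL_regular.const GL_regular.mult)

text \<open>The \<open>(i, j)\<close>-entry of \<open>L * A * R\<close>, written as a polynomial in the entries of \<open>A\<close> so that it is a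
  regular function of arbitrary matrices.\<close>

definition sandwich_entry :: "nat \<Rightarrow> 'k::field mat \<Rightarrow> 'k mat \<Rightarrow> nat \<Rightarrow> nat \<Rightarrow> 'k mat \<Rightarrow> 'k" where
  "sandwich_entry m L R i j A = (\<Sum>l<m. \<Sum>q<m. L $$ (i, l) * A $$ (l, q) * R $$ (q, j))"

lemma sandwich_entry:
  assumes "L \<in> carrier_mat m m" "A \<in> carrier_mat m m" "R \<in> carrier_mat m m" "i < m" "j < m"
  shows "(L * A * R) $$ (i, j) = sandwich_entry m L R i j A"
proof -
  have AR: "A * R \<in> carrier_mat m m" using assms by simp
  have "(L * A * R) $$ (i, j) = (L * (A * R)) $$ (i, j)"
    using square_mult_assoc[OF assms(1-3)] by simp
  also have "\<dots> = (\<Sum>l<m. L $$ (i, l) * (\<Sum>q<m. A $$ (l, q) * R $$ (q, j)))"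
    using assms AR by (simp add: scalar_prod_def lessThan_atLeast0)
  finally show ?thesis by (simp add: sandwich_entry_def sum_distrib_left mult.assoc)
qed

lemma sandwich_entry_regular: "sandwich_entry m L R i j \<in> GL_regular m"
  unfolding sandwich_entry_def
  by (intro GL_regular_sum GL_regular.mult GL_regular.const GL_regular.entry) auto

lemma det_diagonal_monomial_mat: "det (monomial_mat m id a) = (\<Prod>i<m. a i)"
proof -
  have "upper_triangular (monomial_mat m id a)"
    by (auto simp: upper_triangular_def monomial_mat_index)
  then have "det (monomial_mat m id a) = prod_list (diag_mat (monomial_mat m id a))"
    by (rule det_upper_triangular[OF _ monomial_mat_carrier])
  also have "\<dots> = (\<Prod>i<m. monomial_mat m id a $$ (i, i))"
    by (simp add: prod_list_diag_prod lessThan_atLeast0)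
  also have "\<dots> = (\<Prod>i<m. a i)" by (rule prod.cong) (auto simp: monomial_mat_index)
  finally show ?thesis .
qed

lemma diagonal_group_iff:
  "A \<in> diagonal_group r \<longleftrightarrow> (\<exists>a. A = monomial_mat r id a \<and> (\<forall>i<r. a i \<noteq> 0))"
proof
  assume A: "A \<in> diagonal_group r"
  then have Ac: "A \<in> carrier_mat r r" and d: "diagonal_mat A" and nz: "det A \<noteq> 0"
    by (auto simp: diagonal_group_def carrier_GL)
  have eq: "A = monomial_mat r id (\<lambda>i. A $$ (i, i))" by (rule diagonal_eq_monomial_mat[OF Ac d])
  then have "det A = (\<Prod>i<r. A $$ (i, i))" using det_diagonal_monomial_mat by metis
  then have "\<forall>i<r. A $$ (i, i) \<noteq> 0" using nz by simp
  then show "\<exists>a. A = monomial_mat r id a \<and> (\<forall>i<r. a i \<noteq> 0)" using eq by blast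
qed (auto simp: diagonal_group_def carrier_GL det_diagonal_monomial_mat diagonal_monomial_mat)

lemma diagonal_group_index_nonzero: "A \<in> diagonal_group r \<Longrightarrow> i < r \<Longrightarrow> A $$ (i, i) \<noteq> 0"
  by (auto simp: diagonal_group_iff monomial_mat_index)

text \<open>The isomorphism from the full diagonal group to the diagonal symplectic matrices; its inverse
  \<open>torus_coord\<close> takes the upper left block.\<close>

definition torus_param :: "nat \<Rightarrow> 'k::field mat \<Rightarrow> 'k mat" where
  "torus_param n C = monomial_mat (2 * n) id (\<lambda>i. if i < n then C $$ (i, i) else inverse (C $$ (i - n, i - n)))"

definition torus_coord :: "nat \<Rightarrow> 'k::field mat \<Rightarrow> 'k mat" where
  "torus_coord n A = monomial_mat n id (\<lambda>i. A $$ (i, i))"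

lemma torus_param_standard: "C \<in> diagonal_group n \<Longrightarrow> torus_param n C \<in> standard_torus n"
  by (auto simp: standard_torus_iff torus_param_def diagonal_group_index_nonzero intro!: exI)

lemma torus_coord_diagonal:
  assumes "A \<in> standard_torus n"
  shows "torus_coord n A \<in> diagonal_group n"
proof -
  obtain a where a: "A = monomial_mat (2 * n) id a" "\<forall>i<n. a i * a (i + n) = 1"
    using assms by (auto simp: standard_torus_iff)
  have "A $$ (i, i) \<noteq> 0" if "i < n" for i
    using a(2)[rule_format, OF that] that by (auto simp: a(1) monomial_mat_index)
  then show ?thesis unfolding diagonal_group_iff torus_coord_def by blast
qed

lemma torus_coord_param: "C \<in> diagonal_group n \<Longrightarrow> torus_coord n (torus_param n C) = C"
  by (auto simp: diagonal_group_iff torus_coord_def torus_param_def monomial_mat_index intro!: monomial_mat_cong)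

lemma torus_param_coord:
  assumes "A \<in> standard_torus n"
  shows "torus_param n (torus_coord n A) = A"
proof -
  obtain a where a: "A = monomial_mat (2 * n) id a" "\<forall>i<n. a i * a (i + n) = 1"
    using assms by (auto simp: standard_torus_iff)
  have "inverse (a (i - n)) = a i" if "\<not> i < n" "i < 2 * n" for i
  proof -
    have "i - n < n" "i - n + n = i" using that by auto
    then have "a (i - n) * a i = 1" using a(2) by metis
    then show ?thesis by (rule inverse_unique)
  qed
  then show ?thesis unfolding a(1) torus_param_def torus_coord_def
    by (intro monomial_mat_cong) (auto simp: monomial_mat_index)
qed

lemma diagonal_mat_mult:
  "monomial_mat m id a * monomial_mat m id b = monomial_mat m id (\<lambda>i. a i * b i)"
  using monomial_mat_mult[of m id a id b] by simp

lemma torus_coord_mult: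
  assumes "A \<in> standard_torus n" "B \<in> standard_torus n"
  shows "torus_coord n (A * B) = torus_coord n A * torus_coord n B"
proof -
  obtain a b where ab: "A = monomial_mat (2 * n) id a" "B = monomial_mat (2 * n) id b"
    using assms by (auto simp: standard_torus_iff)
  show ?thesis unfolding torus_coord_def ab diagonal_mat_mult
    by (intro monomial_mat_cong refl) (simp add: monomial_mat_index)
qed

lemma torus_param_mult:
  assumes "C \<in> diagonal_group n" "D \<in> diagonal_group n"
  shows "torus_param n (C * D) = torus_param n C * torus_param n D"
proof -
  obtain c d where cd: "C = monomial_mat n id c" "D = monomial_mat n id d"
    using assms by (auto simp: diagonal_group_iff)
  show ?thesis unfolding torus_param_def cd diagonal_mat_mult
    by (intro monomial_mat_cong refl) (auto simp: monomial_mat_index)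
qed

text \<open>On diagonal matrices, the inverse of an entry is the inverse of the determinant times the
  product of the other entries.\<close>

lemma inverse_diagonal_entry_regular:
  assumes i: "i < r"
  shows "\<exists>f\<in>GL_regular r. \<forall>C\<in>diagonal_group r. inverse (C $$ (i, i)) = f C"
proof (intro bexI ballI)
  let ?f = "\<lambda>C. inverse (det C) * (\<Prod>l\<in>{..<r} - {i}. C $$ (l, l))"
  show "?f \<in> GL_regular r"
    by (intro GL_regular.mult GL_regular.inverse_det GL_regular_prod GL_regular.entry) auto
  fix C :: "'a mat" assume C: "C \<in> diagonal_group r"
  then obtain c where c: "C = monomial_mat r id c" "\<forall>i<r. c i \<noteq> 0" by (auto simp: diagonal_group_iff)
  have "(\<Prod>l\<in>{..<r} - {i}. C $$ (l, l)) = (\<Prod>l\<in>{..<r} - {i}. c l)"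
    by (rule prod.cong) (auto simp: c monomial_mat_index)
  moreover have "det C = c i * (\<Prod>l\<in>{..<r} - {i}. c l)"
    unfolding c(1) det_diagonal_monomial_mat using i by (simp add: prod.remove)
  moreover have "(\<Prod>l\<in>{..<r} - {i}. c l) \<noteq> 0" using c(2) by simp
  moreover have "C $$ (i, i) = c i" using i by (simp add: c monomial_mat_index)
  ultimately show "inverse (C $$ (i, i)) = ?f C" by simp
qed

lemma torus_param_regular:
  assumes ij: "i < 2 * n" "j < 2 * n"
  shows "\<exists>f\<in>GL_regular n. \<forall>C\<in>diagonal_group n :: 'k::field mat set. torus_param n C $$ (i, j) = f C"
proof (cases "i = j")
  case False
  then show ?thesis using ij
    by (intro bexI[of _ "\<lambda>_. 0"] ballI GL_regular.const) (simp add: torus_param_def monomial_mat_index)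
next
  case eq: True
  show ?thesis
  proof (cases "i < n")
    case True
    then show ?thesis using ij eq
      by (intro bexI[of _ "\<lambda>C. C $$ (i, i)"] ballI GL_regular.entry)
         (simp_all add: torus_param_def monomial_mat_index)
  next
    case False
    then have "i - n < n" using ij by simp
    then obtain f :: "'k mat \<Rightarrow> 'k" where "f \<in> GL_regular n" "\<forall>C\<in>diagonal_group n. inverse (C $$ (i - n, i - n)) = f C"
      using inverse_diagonal_entry_regular by blast
    then show ?thesis using ij eq False
      by (intro bexI[of _ f] ballI) (simp_all add: torus_param_def monomial_mat_index)
  qed
qed

context
  fixes n :: nat and S S' :: "'k::field mat"
  assumes S: "S \<in> Sp n" and S': "S' \<in> Sp n" and SS': "S * S' = 1\<^sub>m (2 * n)" and S'S: "S' * S = 1\<^sub>m (2 * n)"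
begin

lemma conj_carriers:
  "S \<in> carrier_mat (2 * n) (2 * n)" "S' \<in> carrier_mat (2 * n) (2 * n)"
  using S S' by (auto dest: Sp_carrier)

lemma conj_conj:
  assumes "A \<in> carrier_mat (2 * n) (2 * n)"
  shows "S' * (S * A * S') * S = A" "S * (S' * A * S) * S' = A"
proof -
  have "S' * (S * A * S') * S = (S' * S) * A * (S' * S)"
    using assms conj_carriers by (simp add: square_mult_assoc[of _ "2 * n"])
  then show "S' * (S * A * S') * S = A" using assms by (simp add: S'S)
  have "S * (S' * A * S) * S' = (S * S') * A * (S * S')"
    using assms conj_carriers by (simp add: square_mult_assoc[of _ "2 * n"])
  then show "S * (S' * A * S) * S' = A" using assms by (simp add: SS')
qed

lemma conj_mult:
  assumes "A \<in> carrier_mat (2 * n) (2 * n)" "B \<in> carrier_mat (2 * n) (2 * n)"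
  shows "(S * A * S') * (S * B * S') = S * (A * B) * S'"
proof -
  have "(S * A * S') * (S * B * S') = S * A * (S' * S) * B * S'"
    using assms conj_carriers by (simp add: square_mult_assoc[of _ "2 * n"])
  then show ?thesis using assms conj_carriers by (simp add: S'S square_mult_assoc[of _ "2 * n"])
qed

definition conj_torus :: "'k mat set" where
  "conj_torus = (\<lambda>A. S * A * S') ` standard_torus n"

lemma standard_torus_carrier: "A \<in> standard_torus n \<Longrightarrow> A \<in> carrier_mat (2 * n) (2 * n)"
  by (auto simp: standard_torus_def dest: Sp_carrier)

lemma conj_torus_subset: "conj_torus \<subseteq> Sp n"
proof -
  interpret G: group "matrix_group (2 * n) (Sp n) :: 'k mat monoid" by (rule group_Sp)
  have "S * A * S' \<in> Sp n" if "A \<in> Sp n" for A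
    using G.m_closed[of "S * A" S'] G.m_closed[of S A] that S S' by simp
  then show ?thesis by (auto simp: conj_torus_def standard_torus_def)
qed

lemma conj_torus_iff:
  "B \<in> conj_torus \<longleftrightarrow> B \<in> carrier (GL (2 * n)) \<and> (\<forall>i<2 * n. \<forall>j<2 * n. i \<noteq> j \<longrightarrow> sandwich_entry (2 * n) S' S i j B = 0)
     \<and> (\<forall>i<n. sandwich_entry (2 * n) S' S i i B * sandwich_entry (2 * n) S' S (i + n) (i + n) B = 1)"
    (is "_ \<longleftrightarrow> ?R")
proof
  assume B: "B \<in> conj_torus"
  then have BG: "B \<in> carrier (GL (2 * n))" using conj_torus_subset by (auto simp: Sp_def)
  obtain A where A: "A \<in> standard_torus n" "B = S * A * S'" using B by (auto simp: conj_torus_def)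
  then obtain a where a: "A = monomial_mat (2 * n) id a" "\<forall>i<n. a i * a (i + n) = 1"
    by (auto simp: standard_torus_iff)
  have Bc: "B \<in> carrier_mat (2 * n) (2 * n)" using BG by (simp add: carrier_GL)
  have "S' * B * S = A" unfolding A(2) by (rule conj_conj) (rule standard_torus_carrier[OF A(1)])
  then have "sandwich_entry (2 * n) S' S i j B = (if j = i then a i else 0)" if "i < 2 * n" "j < 2 * n" for i j
    using sandwich_entry[OF conj_carriers(2) Bc conj_carriers(1) that] that by (simp add: a monomial_mat_index)
  then show ?R using BG a(2) by simp
next
  assume R: ?R
  then have Bc: "B \<in> carrier_mat (2 * n) (2 * n)" by (simp add: carrier_GL)
  define A where "A = S' * B * S"
  have Ac: "A \<in> carrier_mat (2 * n) (2 * n)" using Bc conj_carriers by (simp add: A_def)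
  have ent: "A $$ (i, j) = sandwich_entry (2 * n) S' S i j B" if "i < 2 * n" "j < 2 * n" for i j
    unfolding A_def by (rule sandwich_entry[OF conj_carriers(2) Bc conj_carriers(1) that])
  have "diagonal_mat A" using R ent Ac by (auto simp: diagonal_mat_def)
  then have "A = monomial_mat (2 * n) id (\<lambda>i. A $$ (i, i))" by (rule diagonal_eq_monomial_mat[OF Ac])
  moreover have "\<forall>i<n. A $$ (i, i) * A $$ (i + n, i + n) = 1" using R ent by simp
  ultimately have "A \<in> standard_torus n" unfolding standard_torus_iff by blast
  moreover have "B = S * A * S'" unfolding A_def using conj_conj(2)[OF Bc] by simp
  ultimately show "B \<in> conj_torus" unfolding conj_torus_def by blast
qed

lemma conj_torus_closed: "zariski_closed (2 * n) conj_torus"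
proof -
  let ?s = "sandwich_entry (2 * n) S' S"
  let ?F = "{?s i j |i j. i < 2 * n \<and> j < 2 * n \<and> i \<noteq> j} \<union>
    {\<lambda>A. ?s i i A * ?s (i + n) (i + n) A + (- 1) |i. i < n}"
  have reg: "(\<lambda>A. ?s i i A * ?s (i + n) (i + n) A + (- 1)) \<in> GL_regular (2 * n)" for i
    by (intro sandwich_entry_regular GL_regular.add GL_regular.mult GL_regular.const)
  have "?F \<subseteq> GL_regular (2 * n)"
    by (intro Un_least subsetI; elim CollectE exE conjE) (simp_all only: sandwich_entry_regular reg)
  moreover have "conj_torus = {A \<in> carrier (GL (2 * n)). \<forall>f\<in>?F. f A = 0}"
  proof (rule Set.set_eqI)
    fix B
    have "(\<forall>f\<in>?F. f B = 0) \<longleftrightarrow> (\<forall>i<2 * n. \<forall>j<2 * n. i \<noteq> j \<longrightarrow> ?s i j B = 0) \<and>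
        (\<forall>i<n. ?s i i B * ?s (i + n) (i + n) B + (- 1) = 0)"
      unfolding ball_Un by (intro arg_cong2[of _ _ _ _ "(\<and>)"]) auto
    then show "B \<in> conj_torus \<longleftrightarrow> B \<in> {A \<in> carrier (GL (2 * n)). \<forall>f\<in>?F. f A = 0}"
      unfolding conj_torus_iff by simp
  qed
  ultimately show ?thesis unfolding zariski_closed_def by blast
qed

lemma conj_torus_subgroup: "subgroup conj_torus (GL (2 * n))"
proof -
  interpret G: group "GL (2 * n) :: 'k mat monoid" by (rule group_GL)
  interpret P: group "matrix_group (2 * n) (Sp n) :: 'k mat monoid" by (rule group_Sp)
  have T: "subgroup (standard_torus n) (matrix_group (2 * n) (Sp n))" by (rule standard_torus_subgroup)
  show ?thesis
  proof (rule G.subgroupI)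
    show "conj_torus \<subseteq> carrier (GL (2 * n))" using conj_torus_subset by (auto simp: Sp_def)
    show "conj_torus \<noteq> {}" using subgroup.one_closed[OF T] by (auto simp: conj_torus_def)
  next
    fix B assume B: "B \<in> conj_torus"
    then obtain A where A: "A \<in> standard_torus n" "B = S * A * S'" by (auto simp: conj_torus_def)
    let ?I = "inv\<^bsub>matrix_group (2 * n) (Sp n)\<^esub> A"
    have I: "?I \<in> standard_torus n" using subgroup.m_inv_closed[OF T A(1)] .
    have "?I * A = 1\<^sub>m (2 * n)" using P.l_inv[of A] A(1) by (simp add: standard_torus_def)
    moreover have "(S * ?I * S') * B = S * (?I * A) * S'"
      unfolding A(2) by (intro conj_mult standard_torus_carrier I A(1))
    ultimately have "(S * ?I * S') * B = 1\<^sub>m (2 * n)"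
      using conj_carriers by (simp add: SS')
    moreover have B': "S * ?I * S' \<in> conj_torus" using I by (auto simp: conj_torus_def)
    ultimately have "inv\<^bsub>GL (2 * n)\<^esub> B = S * ?I * S'"
      using G.inv_equality[of "S * ?I * S'" B] B conj_torus_subset by (auto simp: Sp_def)
    then show "inv\<^bsub>GL (2 * n)\<^esub> B \<in> conj_torus" using B' by simp
  next
    fix A B assume "A \<in> conj_torus" "B \<in> conj_torus"
    then obtain A' B' where ab: "A' \<in> standard_torus n" "A = S * A' * S'" "B' \<in> standard_torus n" "B = S * B' * S'"
      by (auto simp: conj_torus_def)
    have "A * B = S * (A' * B') * S'"
      unfolding ab by (rule conj_mult) (use ab standard_torus_carrier in auto)
    moreover have "A' * B' \<in> standard_torus n" using subgroup.m_closed[OF T ab(1,3)] by simp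
    ultimately show "A \<otimes>\<^bsub>GL (2 * n)\<^esub> B \<in> conj_torus" by (auto simp: conj_torus_def)
  qed
qed

lemma conj_torus_isomorphic: "algebraic_group_isomorphic (2 * n) conj_torus n (diagonal_group n)"
proof -
  define \<phi> where "\<phi> B = torus_coord n (S' * B * S)" for B
  define \<psi> where "\<psi> C = S * torus_param n C * S'" for C
  have \<phi>S: "\<phi> (S * A * S') = torus_coord n A" if "A \<in> standard_torus n" for A
    using conj_conj(1)[OF standard_torus_carrier[OF that]] by (simp add: \<phi>_def)
  have "algebraic_group_hom (2 * n) conj_torus n (diagonal_group n) \<phi>"
    unfolding algebraic_group_hom_def
  proof (intro conjI homI allI impI)
    fix A assume "A \<in> carrier (matrix_group (2 * n) conj_torus)"
    then show "\<phi> A \<in> carrier (matrix_group n (diagonal_group n))"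
      by (auto simp: conj_torus_def \<phi>S torus_coord_diagonal)
  next
    fix A B assume AB: "A \<in> carrier (matrix_group (2 * n) conj_torus)" "B \<in> carrier (matrix_group (2 * n) conj_torus)"
    then obtain A' B' where ab: "A' \<in> standard_torus n" "A = S * A' * S'" "B' \<in> standard_torus n" "B = S * B' * S'"
      by (auto simp: conj_torus_def)
    have "A * B = S * (A' * B') * S'"
      unfolding ab by (rule conj_mult) (use ab standard_torus_carrier in auto)
    moreover have "A' * B' \<in> standard_torus n" using subgroup.m_closed[OF standard_torus_subgroup ab(1,3)] by simp
    ultimately show "\<phi> (A \<otimes>\<^bsub>matrix_group (2 * n) conj_torus\<^esub> B) = \<phi> A \<otimes>\<^bsub>matrix_group n (diagonal_group n)\<^esub> \<phi> B"
      using ab by (simp add: \<phi>S torus_coord_mult)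
  next
    fix i j assume ij: "i < n" "j < n"
    have ent: "\<phi> B $$ (i, j) = (if j = i then sandwich_entry (2 * n) S' S i i B else 0)" if "B \<in> conj_torus" for B
    proof -
      have "B \<in> carrier_mat (2 * n) (2 * n)" using that conj_torus_subset by (auto dest: Sp_carrier)
      then show ?thesis using ij sandwich_entry[OF conj_carriers(2) _ conj_carriers(1), of B i i]
        by (simp add: \<phi>_def torus_coord_def monomial_mat_index)
    qed
    show "\<exists>f\<in>GL_regular (2 * n). \<forall>A\<in>conj_torus. \<phi> A $$ (i, j) = f A"
    proof (cases "j = i")
      case True
      then show ?thesis using ent by (intro bexI[OF _ sandwich_entry_regular]) auto
    next
      case False
      then show ?thesis using ent by (intro bexI[OF _ GL_regular.const[of 0]]) auto
    qed
  qed
  moreover have "algebraic_group_hom n (diagonal_group n) (2 * n) conj_torus \<psi>"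
    unfolding algebraic_group_hom_def
  proof (intro conjI homI allI impI)
    fix C :: "'k mat" assume "C \<in> carrier (matrix_group n (diagonal_group n))"
    then show "\<psi> C \<in> carrier (matrix_group (2 * n) conj_torus)"
      by (auto simp: conj_torus_def \<psi>_def torus_param_standard)
  next
    fix C D :: "'k mat" assume "C \<in> carrier (matrix_group n (diagonal_group n))" "D \<in> carrier (matrix_group n (diagonal_group n))"
    then have CD: "C \<in> diagonal_group n" "D \<in> diagonal_group n" by auto
    show "\<psi> (C \<otimes>\<^bsub>matrix_group n (diagonal_group n)\<^esub> D) = \<psi> C \<otimes>\<^bsub>matrix_group (2 * n) conj_torus\<^esub> \<psi> D"
      using conj_mult[of "torus_param n C" "torus_param n D"] CD
      by (simp add: \<psi>_def torus_param_mult torus_param_standard standard_torus_carrier)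
  next
    fix i j assume ij: "i < 2 * n" "j < 2 * n"
    have "\<exists>f. l < 2 * n \<longrightarrow> q < 2 * n \<longrightarrow> f \<in> GL_regular n \<and>
        (\<forall>C\<in>diagonal_group n :: 'k mat set. torus_param n C $$ (l, q) = f C)" for l q
      using torus_param_regular[of l n q] by blast
    then obtain f :: "nat \<Rightarrow> nat \<Rightarrow> 'k mat \<Rightarrow> 'k" where f: "\<And>l q. l < 2 * n \<Longrightarrow> q < 2 * n \<Longrightarrow> f l q \<in> GL_regular n \<and>
        (\<forall>C\<in>diagonal_group n. torus_param n C $$ (l, q) = f l q C)"
      by metis
    let ?f = "\<lambda>C. \<Sum>l<2 * n. \<Sum>q<2 * n. S $$ (i, l) * f l q C * S' $$ (q, j)"
    have reg: "?f \<in> GL_regular n"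
      by (intro GL_regular_sum GL_regular.mult GL_regular.const) (use f in auto)
    have ent: "\<psi> C $$ (i, j) = ?f C" if C: "C \<in> diagonal_group n" for C
    proof -
      have "torus_param n C \<in> carrier_mat (2 * n) (2 * n)"
        by (rule standard_torus_carrier[OF torus_param_standard[OF C]])
      then have "\<psi> C $$ (i, j) = sandwich_entry (2 * n) S S' i j (torus_param n C)"
        unfolding \<psi>_def by (intro sandwich_entry conj_carriers ij)
      also have "\<dots> = ?f C"
        unfolding sandwich_entry_def by (intro sum.cong refl) (use f C in auto)
      finally show ?thesis .
    qed
    show "\<exists>f\<in>GL_regular n. \<forall>A\<in>diagonal_group n. \<psi> A $$ (i, j) = f A"
      by (rule bexI[OF _ reg]) (rule ballI, rule ent)
  qed
  moreover have "\<forall>A\<in>conj_torus. \<psi> (\<phi> A) = A"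
    by (auto simp: conj_torus_def \<phi>S \<psi>_def torus_param_coord)
  moreover have "\<forall>C\<in>diagonal_group n. \<phi> (\<psi> C) = C"
    using \<phi>S by (simp add: \<psi>_def torus_param_standard torus_coord_param)
  ultimately show ?thesis unfolding algebraic_group_isomorphic_def by blast
qed

lemma torus_conj_torus: "torus (2 * n) conj_torus"
  unfolding torus_def linear_algebraic_group_def
  using conj_torus_subgroup conj_torus_closed conj_torus_isomorphic by blast

end

section \<open>Maximal tori of the symplectic group\<close>

text \<open>Both properties are transported from the diagonal group. An exponent for a diagonal matrix is
  the product of exponents for its entries. The corresponding power of \<open>A\<close> is then
  an idempotent, and the only idempotent of a group is the identity.\<close>

lemma torus_commutes_and_torsion:
  fixes T :: "'a::{finite,field} alg_closure mat set"
  assumes T: "torus m T" and char: "prime CHAR('a)"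
  shows torus_commute: "A \<in> T \<Longrightarrow> B \<in> T \<Longrightarrow> A * B = B * A"
    and torus_torsion: "A \<in> T \<Longrightarrow> \<exists>k. of_nat k \<noteq> (0 :: 'a alg_closure) \<and> A ^\<^sub>m k = 1\<^sub>m m"
proof -
  interpret G: group "GL m :: 'a alg_closure mat monoid" by (rule group_GL)
  have sub: "subgroup T (GL m)" using T by (simp add: torus_def linear_algebraic_group_def)
  obtain r \<phi> \<psi> where hom: "algebraic_group_hom m T r (diagonal_group r) \<phi>"
    and inj: "\<And>A. A \<in> T \<Longrightarrow> \<psi> (\<phi> A) = A"
    using T unfolding torus_def algebraic_group_isomorphic_def by blast
  have \<phi>: "\<phi> A \<in> diagonal_group r" if "A \<in> T" for A
    using hom that by (auto simp: algebraic_group_hom_def hom_def)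
  have mult: "\<phi> (A * B) = \<phi> A * \<phi> B" if "A \<in> T" "B \<in> T" for A B
    using hom that by (auto simp: algebraic_group_hom_def hom_def)
  have closed: "A * B \<in> T" if "A \<in> T" "B \<in> T" for A B
    using subgroup.m_closed[OF sub that] by simp
  show "A * B = B * A" if AB: "A \<in> T" "B \<in> T" for A B
  proof -
    obtain a b where "\<phi> A = monomial_mat r id a" "\<phi> B = monomial_mat r id b"
      using \<phi>[OF AB(1)] \<phi>[OF AB(2)] unfolding diagonal_group_iff by blast
    then have "\<phi> (A * B) = \<phi> (B * A)"
      by (simp add: mult AB diagonal_mat_mult mult.commute)
    then show ?thesis using inj closed AB by metis
  qed
  show "\<exists>k. of_nat k \<noteq> (0 :: 'a alg_closure) \<and> A ^\<^sub>m k = 1\<^sub>m m" if A: "A \<in> T" for A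
  proof -
    obtain a where a: "\<phi> A = monomial_mat r id a" "\<And>i. i < r \<Longrightarrow> a i \<noteq> 0"
      using \<phi>[OF A] unfolding diagonal_group_iff by blast
    have "\<exists>k. i < r \<longrightarrow> of_nat k \<noteq> (0 :: 'a alg_closure) \<and> a i ^ k = 1" for i
      using alg_closure_order_prime_to_char[OF a(2) char] by metis
    then obtain e where e: "\<And>i. i < r \<Longrightarrow> of_nat (e i) \<noteq> (0 :: 'a alg_closure) \<and> a i ^ e i = 1"
      by metis
    define k where "k = (\<Prod>i<r. e i)"
    have k: "of_nat k \<noteq> (0 :: 'a alg_closure)" using e by (simp add: k_def of_nat_prod)
    have ak: "a i ^ k = 1" if "i < r" for i
    proof -
      have "e i dvd k" unfolding k_def using that by (intro dvd_prodI) auto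
      then obtain l where "k = e i * l" by (rule dvdE)
      then show ?thesis using e[OF that] by (simp add: power_mult)
    qed
    have Ac: "A \<in> carrier_mat m m" using subgroup.mem_carrier[OF sub A] by (simp add: carrier_GL)
    define d where "d j = monomial_mat r id (\<lambda>i. a i ^ j)" for j
    have pow: "A ^\<^sub>m Suc j \<in> T \<and> \<phi> (A ^\<^sub>m Suc j) = d (Suc j)" for j
    proof (induction j)
      case 0
      then show ?case using A Ac a(1) by (simp add: d_def)
    next
      case (Suc j)
      have "\<phi> (A ^\<^sub>m Suc j * A) = d (Suc j) * monomial_mat r id a"
        using mult[of "A ^\<^sub>m Suc j" A] Suc A a(1) by metis
      also have "\<dots> = d (Suc (Suc j))"
        unfolding d_def diagonal_mat_mult by (rule monomial_mat_cong) simp_all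
      finally show ?case using closed[of "A ^\<^sub>m Suc j" A] Suc A by simp
    qed
    obtain j where j: "k = Suc j" using k by (cases k) auto
    let ?B = "A ^\<^sub>m k"
    have B: "?B \<in> T" "\<phi> ?B = d k" using pow[of j] unfolding j by blast+
    have "\<phi> (?B * ?B) = \<phi> ?B"
      unfolding mult[OF B(1) B(1)] B(2) d_def diagonal_mat_mult by (rule monomial_mat_cong) (use ak in auto)
    then have "?B * ?B = ?B" using inj B(1) closed by metis
    moreover have "?B \<in> carrier (GL m)" using subgroup.mem_carrier[OF sub B(1)] .
    ultimately have "?B = 1\<^sub>m m" using G.l_cancel_one[of ?B ?B] by simp
    then show ?thesis using k by blast
  qed
qed

text \<open>In a symplectic basis of common eigenvectors the torus becomes diagonal, so it is contained in a
  conjugate of the diagonal torus. The latter is a torus, and maximality gives equality.\<close>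

lemma maximal_torus_conjugate_standard:
  fixes T :: "'a::{finite,field} alg_closure mat set"
  assumes T: "maximal_torus (2 * n) (Sp n) T" and char: "prime CHAR('a)"
  obtains S where "S \<in> Sp n"
    "T = (\<lambda>A. S * A * inv\<^bsub>matrix_group (2 * n) (Sp n)\<^esub> S) ` standard_torus n"
proof -
  let ?G = "matrix_group (2 * n) (Sp n) :: 'a alg_closure mat monoid"
  interpret G: group ?G by (rule group_Sp)
  have tor: "torus (2 * n) T" and sub: "T \<subseteq> Sp n" using T by (auto simp: maximal_torus_def)
  obtain S where S: "S \<in> Sp n"
    "\<And>A. A \<in> T \<Longrightarrow> \<exists>D\<in>carrier_mat (2 * n) (2 * n). diagonal_mat D \<and> A * S = S * D"
    using symplectic_diagonalization[OF sub torus_commute[OF tor char] torus_torsion[OF tor char]] by metis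
  let ?S' = "inv\<^bsub>?G\<^esub> S"
  have S': "?S' \<in> Sp n" "S * ?S' = 1\<^sub>m (2 * n)" "?S' * S = 1\<^sub>m (2 * n)"
    using G.inv_closed[of S] G.r_inv[of S] G.l_inv[of S] S(1) by auto
  note ctx = S(1) S'
  have c: "S \<in> carrier_mat (2 * n) (2 * n)" "?S' \<in> carrier_mat (2 * n) (2 * n)"
    using S(1) S'(1) by (auto dest: Sp_carrier)
  have "T \<subseteq> conj_torus n S ?S'"
  proof
    fix A assume A: "A \<in> T"
    then have ASp: "A \<in> Sp n" using sub by blast
    then have Ac: "A \<in> carrier_mat (2 * n) (2 * n)" by (rule Sp_carrier)
    obtain D where D: "D \<in> carrier_mat (2 * n) (2 * n)" "diagonal_mat D" "A * S = S * D"
      using S(2)[OF A] by blast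
    have "D = (?S' * S) * D" using D(1) S'(3) by simp
    also have "\<dots> = ?S' * (A * S)" using c D(1) by (simp add: square_mult_assoc[of _ "2 * n"] D(3))
    finally have DA: "D = ?S' * (A * S)" .
    have "D \<in> Sp n" unfolding DA
      using G.m_closed[of ?S' "A * S"] G.m_closed[of A S] S(1) S'(1) ASp by simp
    then have "D \<in> standard_torus n" using D(2) by (simp add: standard_torus_def)
    moreover have "S * D * ?S' = A"
    proof -
      have "S * D * ?S' = A * (S * ?S')" unfolding D(3)[symmetric] using c Ac by (simp add: square_mult_assoc[of _ "2 * n"])
      then show ?thesis using Ac S'(2) by simp
    qed
    ultimately show "A \<in> conj_torus n S ?S'" unfolding conj_torus_def[OF ctx] by blast
  qed
  then have "T = conj_torus n S ?S'"
    using T torus_conj_torus[OF ctx] conj_torus_subset[OF ctx] unfolding maximal_torus_def by blast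
  then show ?thesis using that[OF S(1)] unfolding conj_torus_def[OF ctx] by blast
qed

theorem mainTheorem2:
  fixes p n :: nat
    and \<sigma> :: "'p::prime_card mod_ring alg_closure mat \<Rightarrow> 'p mod_ring alg_closure mat"
    and T :: "'p mod_ring alg_closure mat set"
  assumes "p = CARD('p)"
    and "n \<ge> 1"
    and "steinberg_endomorphism (2 * n) (Sp n) \<sigma>"
    and "maximal_torus (2 * n) (Sp n) T"
    and "\<sigma> ` T \<subseteq> T"
  shows "has_complement (matrix_group (2 * n) (Sp n)) T
           (normalizer (matrix_group (2 * n) (Sp n)) T) \<longleftrightarrow> p = 2"
proof -
  let ?G = "matrix_group (2 * n) (Sp n) :: 'p mod_ring alg_closure mat monoid"
  let ?D = "standard_torus n :: 'p mod_ring alg_closure mat set"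
  interpret G: group ?G by (rule group_Sp)
  have prime: "prime CARD('p)" by (rule prime_card)
  have char: "CHAR('p mod_ring) = CARD('p)" by (rule semiring_char_mod_ring)
  obtain S where S: "S \<in> Sp n" and T: "T = (\<lambda>A. S * A * inv\<^bsub>?G\<^esub> S) ` ?D"
    using maximal_torus_conjugate_standard[OF assms(4)] prime char by metis
  have SG: "S \<in> carrier ?G" using S by simp
  have D: "?D \<subseteq> carrier ?G" by (auto simp: standard_torus_def)
  have T': "T = (\<lambda>A. S \<otimes>\<^bsub>?G\<^esub> A \<otimes>\<^bsub>?G\<^esub> inv\<^bsub>?G\<^esub> S) ` ?D" using T by simp
  have TG: "T \<subseteq> carrier ?G" using assms(4) by (simp add: maximal_torus_def)
  let ?I = "inv\<^bsub>?G\<^esub> S"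
  have conj_back: "(\<lambda>A. ?I \<otimes>\<^bsub>?G\<^esub> A \<otimes>\<^bsub>?G\<^esub> inv\<^bsub>?G\<^esub> ?I) ` T = ?D"
  proof -
    have "?I \<otimes>\<^bsub>?G\<^esub> (S \<otimes>\<^bsub>?G\<^esub> A \<otimes>\<^bsub>?G\<^esub> ?I) \<otimes>\<^bsub>?G\<^esub> inv\<^bsub>?G\<^esub> ?I = A" if "A \<in> carrier ?G" for A
    proof -
      have "?I \<otimes>\<^bsub>?G\<^esub> (S \<otimes>\<^bsub>?G\<^esub> A \<otimes>\<^bsub>?G\<^esub> ?I) \<otimes>\<^bsub>?G\<^esub> inv\<^bsub>?G\<^esub> ?I
          = (?I \<otimes>\<^bsub>?G\<^esub> S) \<otimes>\<^bsub>?G\<^esub> A \<otimes>\<^bsub>?G\<^esub> (?I \<otimes>\<^bsub>?G\<^esub> S)"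
        unfolding G.inv_inv[OF SG] by (simp only: G.m_assoc G.m_closed G.inv_closed SG that)
      then show ?thesis by (simp only: G.l_inv[OF SG] G.l_one G.r_one that)
    qed
    then show ?thesis unfolding T' image_image using D by (simp add: subset_iff cong: image_cong_simp)
  qed
  have "has_complement ?G T (normalizer ?G T) \<longleftrightarrow> has_complement ?G ?D (normalizer ?G ?D)"
    using G.has_complement_conj[OF SG D] G.has_complement_conj[OF G.inv_closed[OF SG] TG]
    unfolding conj_back T'[symmetric] by blast
  also have "\<dots> \<longleftrightarrow> (1 :: 'p mod_ring alg_closure) = - 1"
    using standard_torus_complement_char_2 standard_torus_complement_imp_char_2[OF assms(2)] by blast
  also have "\<dots> \<longleftrightarrow> of_nat 2 = (0 :: 'p mod_ring alg_closure)"
    by (simp add: eq_neg_iff_add_eq_0)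
  also have "\<dots> \<longleftrightarrow> CARD('p) dvd 2"
    by (simp only: of_nat_eq_0_iff_char_dvd CHAR_alg_closure char)
  also have "\<dots> \<longleftrightarrow> p = 2"
    using primes_dvd_imp_eq[OF prime two_is_prime_nat] assms(1) by auto
  finally show ?thesis .
qed

end
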